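(* Let $\epsilon\ge 0$, let $\mathcal{M}=\langle S,L,\tau,\ell\rangle$ and $\mathcal{M}'=\langle S,L,\tau_\epsilon,\ell\rangle$ be labelled Markov chains with $\|\tau(s)-\tau_\epsilon(s)\|_1\le\epsilon$ for all $s\in S$, and let $\epsilon_2>0$ be a compression parameter. Let $(\mathcal{Q}_i)_i$ be the sequence of labelled Markov chains produced on input $(\mathcal{M}',\epsilon_2)$ either by the minimisation algorithm using local bisimilarity distances or by the minimisation algorithm using approximate partition refinement (both described in the context). Then for all $i\in\mathbb{N}$ (for which $\mathcal{Q}_i$ is produced), $\mathcal{Q}_i$ is an $(\epsilon+i\epsilon_2)$-quotient of $\mathcal{M}$.
   Context: A labelled Markov chain (LMC) is a quadruple $\langle S,L,\tau,\ell\rangle$ with $S$ a nonempty finite set of states, $L$ a nonempty finite set of labels, $\tau:S\to\mathrm{Distr}(S)$ a transition function ($\mathrm{Distr}(S)$ is the set of probability distributions on $S$), and $\ell:S\to L$ a labelling function. For $E\subseteq S$ write $\tau(s)(E)=\sum_{t\in E}\tau(s)(t)$. $\|\cdot\|_1$ is the $L_1$-norm. An equivalence relation $\mathcal{R}\subseteq S\times S$ is a probabilistic bisimulation if for all $(s,t)\in\mathcal{R}$ we have $\ell(s)=\ell(t)$ and $\tau(s)(E)=\tau(t)(E)$ for each $\mathcal{R}$-equivalence class $E$. Probabilistic bisimilarity $\sim_{\mathcal{M}}$ is the largest probabilistic bisimulation on $\mathcal{M}$. A probabilistic bisimulation $\mathcal{R}$ induces the quotient LMC $\mathcal{M}/_{\mathcal{R}}=\langle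 S/_{\mathcal{R}},L,\tau/_{\mathcal{R}},\ell/_{\mathcal{R}}\rangle$ with $\tau/_{\mathcal{R}}([s])([t])=\tau(s)([t])$ and $\ell/_{\mathcal{R}}([s])=\ell(s)$. For $\epsilon\ge 0$, an LMC $\mathcal{Q}$ is an $\epsilon$-quotient of $\mathcal{M}=\langle S,L,\tau,\ell\rangle$ if there is a transition function $\tau':S\to\mathrm{Distr}(S)$ with $\|\tau'(s)-\tau(s)\|_1\le\epsilon$ for all $s\in S$ such that $\mathcal{Q}$ is (up to isomorphism, i.e. renaming of states) the bisimulation quotient $\mathcal{N}/_{\sim_{\mathcal{N}}}$ of $\mathcal{N}=\langle S,L,\tau',\ell\rangle$. Local bisimilarity distance: for an LMC $\mathcal{M}=\langle S,L,\tau,\ell\rangle$ and $s\ne t$ in $S$ with $\ell(s)=\ell(t)$, let $\mathrm{T}$ be the set of transition functions $\tau'$ on $S$ with $\tau'(x)=\tau(x)$ for all $x\notin\{s,t\}$ and such that $\{s,t\}\in S/_{\mathcal{R}}$ for some probabilistic bisimulation $\mathcal{R}$ of $\langle S,L,\tau',\ell\rangle$; then $d_{\mathrm{local}}^{\mathcal{M}}(s,t)=\inf_{\tau'\in\mathrm{T}}\max\{\|\tau'(s)-\tau(s)\|_1,\|\tau'(t)-\tau(t)\|_1\}$. The partition of $S$ associated with $(s,t)$ is $S/_{\sim_{\mathcal{M}''}}$, where $\mathcal{M}''$ is obtained from $\mathcal{M}$ by giving $s$ and $t$ (only) a common new label and making both absorbing (self-loop with probability $1$); it contains $\{s,t\}$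 as a block. Write $\mathcal{Q}_i=\langle S^{\mathcal{Q}_i},L,\tau^{\mathcal{Q}_i},\ell^{\mathcal{Q}_i}\rangle$. Both algorithms start with $\mathcal{Q}_0=\mathcal{M}'/_{\sim_{\mathcal{M}'}}$. Minimisation using local bisimilarity distances: while there are $u\ne v$ in $S^{\mathcal{Q}_i}$ with equal labels and $d_{\mathrm{local}}^{\mathcal{Q}_i}(u,v)\le\epsilon_2$, choose $(s,t)$ minimising $d_{\mathrm{local}}^{\mathcal{Q}_i}$ among pairs of different states with equal labels; let $X_i$ be the partition of $S^{\mathcal{Q}_i}$ associated with $(s,t)$; let $\mathcal{M}_{i+1}$ be the LMC with state space $X_i$, where a block $E\ne\{s,t\}$ has transition distribution $(\tau^{\mathcal{Q}_i}(u)(E'))_{E'\in X_i}$ for any $u\in E$, the block $\{s,t\}$ has transition distribution $\frac12\big((\tau^{\mathcal{Q}_i}(s)(E'))_{E'\in X_i}+(\tau^{\mathcal{Q}_i}(t)(E'))_{E'\in X_i}\big)$, and the label of $E$ is $\ell^{\mathcal{Q}_i}(u)$ for any $u\in E$; set $\mathcal{Q}_{i+1}=\mathcal{M}_{i+1}/_{\sim_{\mathcal{M}_{i+1}}}$ and increment $i$. Approximate partition refinement, on an LMC $\langle S,L,\tau,\ell\rangle$ with parameter $\epsilon_2$: let $Y_0=\{S\}$. For $j=1,2,\dots$ compute $Y_j$ from $Y_{j-1}$ as follows, until $Y_j=Y_{j-1}$, and output this final partition. For each $E\in Y_{j-1}$, build a partition $X_E$ of $E$, starting with $X_E=\emptyset$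 and processing the states $s\in E$ one by one (in arbitrary order): let $ESet$ be the set of $E'\in X_E$ such that for all $t\in E'$ we have $\ell(s)=\ell(t)$ and $\|(\tau(s)(F))_{F\in Y_{j-1}}-(\tau(t)(F))_{F\in Y_{j-1}}\|_1\le\epsilon_2$; if $ESet=\emptyset$, add $\{s\}$ to $X_E$; otherwise choose $E'\in ESet$ minimising the average $\frac{1}{|E'|}\sum_{t\in E'}\|(\tau(s)(F))_{F\in Y_{j-1}}-(\tau(t)(F))_{F\in Y_{j-1}}\|_1$ and replace $E'$ by $E'\cup\{s\}$ in $X_E$. Then $Y_j=\bigcup_{E\in Y_{j-1}}X_E$. Minimisation using approximate partition refinement: repeat the following until $|S^{\mathcal{Q}_{i}}|=|S^{\mathcal{Q}_{i-1}}|$ (tested after each round): let $X_i$ be the output of approximate partition refinement on $\mathcal{Q}_i$ with $\epsilon_2$; let $\mathcal{M}_{i+1}$ be the LMC with state space $X_i$, transition function $E\mapsto\frac{1}{|E|}\sum_{u\in E}(\tau^{\mathcal{Q}_i}(u)(E'))_{E'\in X_i}$ and label $\ell^{\mathcal{Q}_i}(x)$ of $E$ for any $x\in E$; set $\mathcal{Q}_{i+1}=\mathcal{M}_{i+1}/_{\sim_{\mathcal{M}_{i+1}}}$ and increment $i$. *)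

theory Defs
  imports "HOL-Probability.Probability"
begin

section \<open>Labelled Markov chains\<close>

record ('s, 'l) lmc =
  states :: "'s set"
  labels :: "'l set"
  tau :: "'s \<Rightarrow> 's pmf"
  label :: "'s \<Rightarrow> 'l"

text \<open>A distribution on the finite carrier is a pmf whose support lies in the carrier; the values of
  \<^const>\<open>tau\<close> and \<^const>\<open>label\<close> outside of the carrier are irrelevant.\<close>

definition is_lmc :: "('s, 'l) lmc \<Rightarrow> bool" where
  "is_lmc M \<longleftrightarrow>
     finite (states M) \<and> states M \<noteq> {} \<and> finite (labels M) \<and> labels M \<noteq> {} \<and>
     (\<forall>s\<in>states M. set_pmf (tau M s) \<subseteq> states M \<and> label M s \<in> labels M)"

text \<open>The \<open>L\<^sub>1\<close>-norm of the difference of two vectors indexed by \<open>I\<close>. It is used both for distributions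
  (\<open>I\<close> a set of states) and for vectors of block probabilities (\<open>I\<close> a partition).\<close>

definition l1_dist :: "'i set \<Rightarrow> ('i \<Rightarrow> real) \<Rightarrow> ('i \<Rightarrow> real) \<Rightarrow> real" where
  "l1_dist I f g = (\<Sum>x\<in>I. \<bar>f x - g x\<bar>)"

definition lmc_iso :: "('s, 'l) lmc \<Rightarrow> ('t, 'l) lmc \<Rightarrow> bool" where
  "lmc_iso A B \<longleftrightarrow> labels A = labels B \<and>
     (\<exists>f. bij_betw f (states A) (states B) \<and>
        (\<forall>s\<in>states A. label B (f s) = label A s \<and>
           (\<forall>t\<in>states A. pmf (tau B (f s)) (f t) = pmf (tau A s) t)))"


section \<open>Bisimulations and quotients\<close>

definition bisimulation :: "('s, 'l) lmc \<Rightarrow> ('s \<times> 's) set \<Rightarrow> bool" where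
  "bisimulation M R \<longleftrightarrow> equiv (states M) R \<and>
     (\<forall>(s, t)\<in>R. label M s = label M t \<and>
        (\<forall>E\<in>states M // R. measure_pmf.prob (tau M s) E = measure_pmf.prob (tau M t) E))"

definition bisimilarity :: "('s, 'l) lmc \<Rightarrow> ('s \<times> 's) set" where
  "bisimilarity M = (GREATEST R. bisimulation M R)"

lemma bisimilarity_greatest:
  assumes M: "is_lmc M"
  shows "bisimulation M (bisimilarity M)"
    and "bisimulation M R \<Longrightarrow> R \<subseteq> bisimilarity M"
proof -
  define B where "B = \<Union>{R. bisimulation M R}"
  define U where "U = B\<^sup>+"
  have le: "R \<subseteq> U" if "bisimulation M R" for R
    using that by (auto simp: U_def B_def)
  have idS: "bisimulation M (Id_on (states M))"
    by (auto simp: bisimulation_def equiv_def refl_on_def sym_def trans_def)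
  have sub: "B \<subseteq> states M \<times> states M"
    by (auto simp: B_def bisimulation_def equiv_def)
  have eq: "equiv (states M) U"
  proof (rule equivI)
    show "U \<subseteq> states M \<times> states M" unfolding U_def using sub by (rule trancl_subset_Sigma)
    show "refl_on (states M) U" using le[OF idS] by (auto simp: refl_on_def)
    have "sym B" by (auto simp: B_def bisimulation_def equiv_def sym_def)
    then show "sym U" unfolding U_def by (rule sym_trancl)
    show "trans U" by (simp add: U_def)
  qed
  have one: "label M s = label M t \<and>
      (\<forall>E\<in>states M // U. measure_pmf.prob (tau M s) E = measure_pmf.prob (tau M t) E)"
    if "(s, t) \<in> B" for s t
  proof -
    obtain R where R: "bisimulation M R" "(s, t) \<in> R" using \<open>(s,t) \<in> B\<close> by (auto simp: B_def)
    have eR: "equiv (states M) R" using R by (simp add: bisimulation_def)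
    have lab: "label M s = label M t" and
      pr: "\<And>F. F \<in> states M // R \<Longrightarrow> measure_pmf.prob (tau M s) F = measure_pmf.prob (tau M t) F"
      using R by (auto simp: bisimulation_def)
    have "measure_pmf.prob (tau M s) E = measure_pmf.prob (tau M t) E" if E: "E \<in> states M // U" for E
    proof -
      define FF where "FF = {F \<in> states M // R. F \<subseteq> E}"
      have ES: "E \<subseteq> states M" using E eq by (metis Union_quotient Union_upper)
      have "x \<in> \<Union>FF" if x: "x \<in> E" for x
      proof -
        have xS: "x \<in> states M" using x ES by auto
        have "R `` {x} \<subseteq> E"
        proof
          fix y assume "y \<in> R `` {x}"
          then have "(x, y) \<in> U" using le[OF R(1)] by auto
          then show "y \<in> E" using E x eq by (meson in_quotient_imp_closed)
        qed
        moreover have "x \<in> R `` {x}" using eR xS by (rule equiv_class_self)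
        ultimately show ?thesis using xS by (auto simp: FF_def intro: quotientI)
      qed
      then have EF: "E = \<Union>FF" by (auto simp: FF_def)
      have fin: "finite FF"
        using M eR by (auto simp: FF_def is_lmc_def equiv_def intro: finite_subset[OF _ finite_quotient])
      have dis: "disjoint FF"
        using partition_onD2[OF partition_on_quotient[OF eR]] by (auto simp: FF_def disjoint_def)
      have "measure_pmf.prob p E = (\<Sum>F\<in>FF. measure_pmf.prob p F)" for p
        unfolding EF using fin dis
        by (subst measure_pmf.finite_measure_finite_Union[of FF "\<lambda>x. x", simplified])
           (auto simp: disjoint_def disjoint_family_on_def)
      then show ?thesis using pr by (auto simp: FF_def)
    qed
    with lab show ?thesis by blast
  qed
  have "label M s = label M t \<and>
      (\<forall>E\<in>states M // U. measure_pmf.prob (tau M s) E = measure_pmf.prob (tau M t) E)"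
    if "(s, t) \<in> U" for s t
    using that unfolding U_def
  proof (induction rule: trancl_induct)
    case (base y) then show ?case using one by (simp add: U_def)
  next
    case (step y z) then show ?case using one[of y z] by (simp add: U_def)
  qed
  with eq have U: "bisimulation M U" unfolding bisimulation_def by blast
  have "bisimilarity M = U" unfolding bisimilarity_def
    by (rule Greatest_equality) (use U le in auto)
  with U le show "bisimulation M (bisimilarity M)" "bisimulation M R \<Longrightarrow> R \<subseteq> bisimilarity M"
    by auto
qed

text \<open>For a partition \<open>X\<close> of the carrier, the distribution on \<open>X\<close> that assigns to a block \<open>E\<close> the
  probability of \<open>E\<close>; see \<open>pmf_block_distr\<close> below.\<close>

definition block_distr :: "'s set set \<Rightarrow> 's pmf \<Rightarrow> 's set pmf" where
  "block_distr X p = map_pmf (\<lambda>t. THE E. E \<in> X \<and> t \<in> E) p"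

lemma pmf_block_distr:
  assumes X: "partition_on S X" and p: "set_pmf p \<subseteq> S" and E: "E \<in> X"
  shows "pmf (block_distr X p) E = measure_pmf.prob p E"
proof -
  have uniq: "(THE F. F \<in> X \<and> t \<in> F) = F" if "F \<in> X" "t \<in> F" for t F
    using that X by (auto simp: partition_on_def disjoint_def intro!: the_equality)
  have "(THE F. F \<in> X \<and> t \<in> F) = E \<longleftrightarrow> t \<in> E" if t: "t \<in> set_pmf p" for t
  proof -
    obtain F where F: "F \<in> X" "t \<in> F"
      using t p X by (auto simp: partition_on_def)
    show ?thesis
      using uniq[OF F] uniq[OF E] F by metis
  qed
  then have "measure_pmf.prob p ((\<lambda>t. THE F. F \<in> X \<and> t \<in> F) -` {E}) = measure_pmf.prob p E"
    by (intro measure_pmf.finite_measure_eq_AE) (auto simp: AE_measure_pmf_iff)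
  then show ?thesis
    by (simp add: block_distr_def pmf_map)
qed

text \<open>For a bisimulation \<open>R\<close>, transitions and labels of a class do not depend on the chosen element.\<close>

definition lmc_quotient :: "('s, 'l) lmc \<Rightarrow> ('s \<times> 's) set \<Rightarrow> ('s set, 'l) lmc" where
  "lmc_quotient M R =
     \<lparr>states = states M // R,
      labels = labels M,
      tau = (\<lambda>E. block_distr (states M // R) (tau M (SOME s. s \<in> E))),
      label = (\<lambda>E. label M (SOME s. s \<in> E))\<rparr>"

definition bisim_quotient :: "('s, 'l) lmc \<Rightarrow> ('s set, 'l) lmc" where
  "bisim_quotient M = lmc_quotient M (bisimilarity M)"

definition eps_quotient :: "real \<Rightarrow> ('s, 'l) lmc \<Rightarrow> ('q, 'l) lmc \<Rightarrow> bool" where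
  "eps_quotient \<epsilon> M Q \<longleftrightarrow> is_lmc Q \<and>
     (\<exists>\<tau>'. is_lmc (M\<lparr>tau := \<tau>'\<rparr>) \<and>
        (\<forall>s\<in>states M. l1_dist (states M) (pmf (\<tau>' s)) (pmf (tau M s)) \<le> \<epsilon>) \<and>
        lmc_iso (bisim_quotient (M\<lparr>tau := \<tau>'\<rparr>)) Q)"


section \<open>Minimisation using local bisimilarity distances\<close>

definition local_transitions :: "('s, 'l) lmc \<Rightarrow> 's \<Rightarrow> 's \<Rightarrow> ('s \<Rightarrow> 's pmf) set" where
  "local_transitions M s t =
     {\<tau>'. is_lmc (M\<lparr>tau := \<tau>'\<rparr>) \<and> (\<forall>x\<in>states M - {s, t}. \<tau>' x = tau M x) \<and>
          (\<exists>R. bisimulation (M\<lparr>tau := \<tau>'\<rparr>) R \<and> {s, t} \<in> states M // R)}"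

text \<open>Making \<open>s\<close> and \<open>t\<close> absorbing shows that the infimum is over a nonempty set.\<close>

lemma local_transitions_nonempty:
  assumes M: "is_lmc M" and st: "s \<in> states M" "t \<in> states M" "label M s = label M t"
  shows "local_transitions M s t \<noteq> {}"
proof -
  let ?\<tau> = "(tau M)(s := return_pmf s, t := return_pmf t)"
  let ?R = "Id_on (states M) \<union> {s, t} \<times> {s, t}"
  have eq: "equiv (states M) ?R"
    using st by (intro equivI) (auto simp: refl_on_def sym_def trans_def)
  have prob: "measure_pmf.prob (?\<tau> x) E = measure_pmf.prob (?\<tau> y) E"
    if xy: "(x, y) \<in> ?R" and E: "E \<in> states M // ?R" for x y E
  proof (cases "x = y")
    case False
    then have "x \<in> {s, t}" "y \<in> {s, t}"
      using xy by auto
    moreover have "s \<in> E \<longleftrightarrow> t \<in> E"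
    proof -
      have "(s, t) \<in> ?R" "(t, s) \<in> ?R"
        by auto
      then show ?thesis
        using in_quotient_imp_closed[OF eq E] by blast
    qed
    ultimately show ?thesis
      by (auto simp: measure_return_pmf indicator_def)
  qed simp
  have "bisimulation (M\<lparr>tau := ?\<tau>\<rparr>) ?R"
  proof -
    have "label M x = label M y" if "(x, y) \<in> ?R" for x y
      using that st by auto
    with eq prob show ?thesis
      unfolding bisimulation_def by (auto simp del: fun_upd_apply Un_insert_left Un_insert_right)
  qed
  moreover have "{s, t} \<in> states M // ?R"
  proof -
    have "?R `` {s} = {s, t}"
      by auto
    then show ?thesis
      using st(1) by (metis quotientI)
  qed
  moreover have "is_lmc (M\<lparr>tau := ?\<tau>\<rparr>)"
    using M st by (auto simp: is_lmc_def)
  ultimately have "?\<tau> \<in> local_transitions M s t"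
    unfolding local_transitions_def by auto
  then show ?thesis
    by blast
qed

definition d_local :: "('s, 'l) lmc \<Rightarrow> 's \<Rightarrow> 's \<Rightarrow> real" where
  "d_local M s t =
     (INF \<tau>'\<in>local_transitions M s t.
        max (l1_dist (states M) (pmf (\<tau>' s)) (pmf (tau M s)))
            (l1_dist (states M) (pmf (\<tau>' t)) (pmf (tau M t))))"

text \<open>The new label shared by \<open>s\<close> and \<open>t\<close> is \<^const>\<open>None\<close>.\<close>

definition absorbing_lmc :: "('s, 'l) lmc \<Rightarrow> 's \<Rightarrow> 's \<Rightarrow> ('s, 'l option) lmc" where
  "absorbing_lmc M s t =
     \<lparr>states = states M,
      labels = insert None (Some ` labels M),
      tau = (tau M)(s := return_pmf s, t := return_pmf t),
      label = (\<lambda>x. if x \<in> {s, t} then None else Some (label M x))\<rparr>"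

definition assoc_partition :: "('s, 'l) lmc \<Rightarrow> 's \<Rightarrow> 's \<Rightarrow> 's set set" where
  "assoc_partition M s t = states M // bisimilarity (absorbing_lmc M s t)"

text \<open>The uniform average \<open>(1 / |E|) * (\<Sum>u\<in>E. f u)\<close> of distributions, see \<open>pmf_bind_pmf_of_set\<close>;
  for \<open>E = {s, t}\<close> with \<open>s \<noteq> t\<close> this is \<open>(f s + f t) / 2\<close>.\<close>

definition average_distr :: "'s set \<Rightarrow> ('s \<Rightarrow> 'a pmf) \<Rightarrow> 'a pmf" where
  "average_distr E f = bind_pmf (pmf_of_set E) f"

definition local_merge :: "('s, 'l) lmc \<Rightarrow> 's \<Rightarrow> 's \<Rightarrow> ('s set, 'l) lmc" where
  "local_merge M s t = (let X = assoc_partition M s t in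
     \<lparr>states = X,
      labels = labels M,
      tau = (\<lambda>E. if E = {s, t} then average_distr {s, t} (\<lambda>u. block_distr X (tau M u))
                 else block_distr X (tau M (SOME u. u \<in> E))),
      label = (\<lambda>E. label M (SOME u. u \<in> E))\<rparr>)"

definition mergeable_pairs :: "('s, 'l) lmc \<Rightarrow> ('s \<times> 's) set" where
  "mergeable_pairs M = {(u, v). u \<in> states M \<and> v \<in> states M \<and> u \<noteq> v \<and> label M u = label M v}"

text \<open>One iteration of the loop, including the test of the loop condition. LMCs produced by the
  algorithms are considered up to renaming of states, so that all of them can share one state
  type.\<close>

definition local_step :: "real \<Rightarrow> ('q, 'l) lmc \<Rightarrow> ('q, 'l) lmc \<Rightarrow> bool" where
  "local_step \<epsilon>\<^sub>2 Q Q' \<longleftrightarrow>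
     (\<exists>(u, v)\<in>mergeable_pairs Q. d_local Q u v \<le> \<epsilon>\<^sub>2) \<and>
     (\<exists>(s, t)\<in>mergeable_pairs Q.
        (\<forall>(u, v)\<in>mergeable_pairs Q. d_local Q s t \<le> d_local Q u v) \<and>
        lmc_iso (bisim_quotient (local_merge Q s t)) Q')"

text \<open>\<open>Q 0, \<dots>, Q n\<close> are the first \<open>n + 1\<close> LMCs produced by a (not necessarily completed) run.\<close>

definition local_run :: "('s, 'l) lmc \<Rightarrow> real \<Rightarrow> (nat \<Rightarrow> ('q, 'l) lmc) \<Rightarrow> nat \<Rightarrow> bool" where
  "local_run M' \<epsilon>\<^sub>2 Q n \<longleftrightarrow>
     lmc_iso (bisim_quotient M') (Q 0) \<and> (\<forall>i<n. local_step \<epsilon>\<^sub>2 (Q i) (Q (Suc i)))"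


section \<open>Minimisation using approximate partition refinement\<close>

definition block_dist :: "('s, 'l) lmc \<Rightarrow> 's set set \<Rightarrow> 's \<Rightarrow> 's \<Rightarrow> real" where
  "block_dist M Y s t = l1_dist Y (measure_pmf.prob (tau M s)) (measure_pmf.prob (tau M t))"

definition ESet :: "('s, 'l) lmc \<Rightarrow> real \<Rightarrow> 's set set \<Rightarrow> 's set set \<Rightarrow> 's \<Rightarrow> 's set set" where
  "ESet M \<epsilon>\<^sub>2 Y X s = {E'\<in>X. \<forall>t\<in>E'. label M s = label M t \<and> block_dist M Y s t \<le> \<epsilon>\<^sub>2}"

definition average_dist :: "('s, 'l) lmc \<Rightarrow> 's set set \<Rightarrow> 's \<Rightarrow> 's set \<Rightarrow> real" where
  "average_dist M Y s E' = (1 / real (card E')) * (\<Sum>t\<in>E'. block_dist M Y s t)"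

text \<open>\<open>apr_insert M \<epsilon>\<^sub>2 Y s X X'\<close>: with \<open>Y\<close> the partition of the previous round, processing \<open>s\<close>
  may turn \<open>X\<close> into \<open>X'\<close>. The relation need not be functional, as the minimiser need not be unique.\<close>

inductive apr_insert ::
  "('s, 'l) lmc \<Rightarrow> real \<Rightarrow> 's set set \<Rightarrow> 's \<Rightarrow> 's set set \<Rightarrow> 's set set \<Rightarrow> bool"
  for M \<epsilon>\<^sub>2 Y s X where
  new_block: "ESet M \<epsilon>\<^sub>2 Y X s = {} \<Longrightarrow> apr_insert M \<epsilon>\<^sub>2 Y s X (insert {s} X)"
| join_block: "E' \<in> ESet M \<epsilon>\<^sub>2 Y X s \<Longrightarrow>
    (\<And>E''. E'' \<in> ESet M \<epsilon>\<^sub>2 Y X s \<Longrightarrow> average_dist M Y s E' \<le> average_dist M Y s E'') \<Longrightarrow>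
    apr_insert M \<epsilon>\<^sub>2 Y s X (insert (E' \<union> {s}) (X - {E'}))"

inductive apr_process ::
  "('s, 'l) lmc \<Rightarrow> real \<Rightarrow> 's set set \<Rightarrow> 's list \<Rightarrow> 's set set \<Rightarrow> 's set set \<Rightarrow> bool"
  for M \<epsilon>\<^sub>2 Y where
  "apr_process M \<epsilon>\<^sub>2 Y [] X X"
| "apr_insert M \<epsilon>\<^sub>2 Y s X X' \<Longrightarrow> apr_process M \<epsilon>\<^sub>2 Y ss X' X'' \<Longrightarrow>
    apr_process M \<epsilon>\<^sub>2 Y (s # ss) X X''"

text \<open>The list \<open>ss\<close> is the arbitrary order in which the states of \<open>E\<close> are processed.\<close>

definition apr_split :: "('s, 'l) lmc \<Rightarrow> real \<Rightarrow> 's set set \<Rightarrow> 's set \<Rightarrow> 's set set \<Rightarrow> bool" where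
  "apr_split M \<epsilon>\<^sub>2 Y E X \<longleftrightarrow> (\<exists>ss. distinct ss \<and> set ss = E \<and> apr_process M \<epsilon>\<^sub>2 Y ss {} X)"

definition apr_refine :: "('s, 'l) lmc \<Rightarrow> real \<Rightarrow> 's set set \<Rightarrow> 's set set \<Rightarrow> bool" where
  "apr_refine M \<epsilon>\<^sub>2 Y Y' \<longleftrightarrow>
     (\<exists>X. (\<forall>E\<in>Y. apr_split M \<epsilon>\<^sub>2 Y E (X E)) \<and> Y' = (\<Union>E\<in>Y. X E))"

text \<open>\<open>Y 0, \<dots>, Y k\<close> are the partitions computed, and \<open>k\<close> is the first index at which the partition
  is unchanged.\<close>

definition apr_output :: "('s, 'l) lmc \<Rightarrow> real \<Rightarrow> 's set set \<Rightarrow> bool" where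
  "apr_output M \<epsilon>\<^sub>2 X \<longleftrightarrow>
     (\<exists>Y (k::nat). Y 0 = {states M} \<and> 1 \<le> k \<and>
        (\<forall>j\<in>{1..k}. apr_refine M \<epsilon>\<^sub>2 (Y (j - 1)) (Y j)) \<and>
        (\<forall>j\<in>{1..<k}. Y j \<noteq> Y (j - 1)) \<and>
        Y k = Y (k - 1) \<and> X = Y k)"

definition apr_merge :: "('s, 'l) lmc \<Rightarrow> 's set set \<Rightarrow> ('s set, 'l) lmc" where
  "apr_merge M X =
     \<lparr>states = X,
      labels = labels M,
      tau = (\<lambda>E. average_distr E (\<lambda>u. block_distr X (tau M u))),
      label = (\<lambda>E. label M (SOME x. x \<in> E))\<rparr>"

definition apr_step :: "real \<Rightarrow> ('q, 'l) lmc \<Rightarrow> ('q, 'l) lmc \<Rightarrow> bool" where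
  "apr_step \<epsilon>\<^sub>2 Q Q' \<longleftrightarrow>
     (\<exists>X. apr_output Q \<epsilon>\<^sub>2 X \<and> lmc_iso (bisim_quotient (apr_merge Q X)) Q')"

text \<open>The termination test is made after each round, so the first round is always executed.\<close>

definition apr_run :: "('s, 'l) lmc \<Rightarrow> real \<Rightarrow> (nat \<Rightarrow> ('q, 'l) lmc) \<Rightarrow> nat \<Rightarrow> bool" where
  "apr_run M' \<epsilon>\<^sub>2 Q n \<longleftrightarrow>
     lmc_iso (bisim_quotient M') (Q 0) \<and>
     (\<forall>i<n. (i = 0 \<or> card (states (Q i)) \<noteq> card (states (Q (i - 1)))) \<and>
            apr_step \<epsilon>\<^sub>2 (Q i) (Q (Suc i)))"

end

theory Submission
  imports Defs
begin

text \<open>Let \<open>N\<close> be the perturbation of \<open>M\<close> on the original state space whose bisimulation quotient is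
  \<open>Q\<^sub>i\<close>. A merging step changes the block probabilities of a state of \<open>Q\<^sub>i\<close> by at most \<open>\<epsilon>\<^sub>2\<close> in norm.
  This change lifts along the quotient map to a change of \<open>N\<close> of the same size, so that the merged
  chain is again a quotient of a perturbation of \<open>M\<close>, and the errors add up. For local distances the
  step is bounded since averaging two distributions costs half of their distance, and that distance
  is at most \<open>2 d\<^sub>l\<^sub>o\<^sub>c\<^sub>a\<^sub>l(s, t)\<close>. For partition refinement it is bounded since the output partition is a
  fixed point, so that states in one block are \<open>\<epsilon>\<^sub>2\<close>-close with respect to that same partition.

  Bisimulations are handled as kernels of surjective homomorphisms.\<close>

section \<open>Lifting distributions along maps\<close>

lemma l1_dist_commute: "l1_dist I f g = l1_dist I g f"
  by (simp add: l1_dist_def abs_minus_commute)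

lemma l1_dist_same [simp]: "l1_dist I f f = 0"
  by (simp add: l1_dist_def)

lemma l1_dist_triangle: "l1_dist I f h \<le> l1_dist I f g + l1_dist I g h"
  unfolding l1_dist_def sum.distrib[symmetric] by (intro sum_mono) auto

text \<open>Convexity of the norm: the difference to an average is the average of the differences.
  With \<open>g\<close> the distribution of a member of \<open>E\<close>, that member's own term is
  0, which gives the factor one half when two states are merged.\<close>

lemma l1_dist_average_distr:
  assumes "finite E" "E \<noteq> {}"
  shows "l1_dist I g (pmf (average_distr E f)) \<le> (\<Sum>u\<in>E. l1_dist I g (pmf (f u))) / card E"
proof -
  have c: "real (card E) > 0"
    using assms by (simp add: card_gt_0_iff)
  have "\<bar>g i - pmf (average_distr E f) i\<bar> \<le> (\<Sum>u\<in>E. \<bar>g i - pmf (f u) i\<bar>) / card E" for i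
  proof -
    have "g i - pmf (average_distr E f) i = (\<Sum>u\<in>E. g i - pmf (f u) i) / card E"
      using assms c by (simp add: average_distr_def pmf_bind_pmf_of_set sum_subtractf field_simps)
    also have "\<bar>\<dots>\<bar> \<le> (\<Sum>u\<in>E. \<bar>g i - pmf (f u) i\<bar>) / card E"
      using c by (simp add: divide_right_mono)
    finally show ?thesis .
  qed
  then have "l1_dist I g (pmf (average_distr E f)) \<le> (\<Sum>i\<in>I. (\<Sum>u\<in>E. \<bar>g i - pmf (f u) i\<bar>) / card E)"
    unfolding l1_dist_def by (rule sum_mono)
  also have "\<dots> = (\<Sum>u\<in>E. l1_dist I g (pmf (f u))) / card E"
    unfolding l1_dist_def sum_divide_distrib[symmetric] by (subst sum.swap) simp
  finally show ?thesis .
qed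

lemma pmf_map_sum:
  assumes "finite S" "set_pmf p \<subseteq> S"
  shows "pmf (map_pmf f p) y = (\<Sum>x\<in>{x\<in>S. f x = y}. pmf p x)"
proof -
  have "pmf (map_pmf f p) y = measure_pmf.prob p (f -` {y})"
    by (simp add: pmf_map)
  also have "\<dots> = measure_pmf.prob p {x\<in>S. f x = y}"
    using assms(2) by (intro measure_pmf.finite_measure_eq_AE) (auto simp: AE_measure_pmf_iff)
  finally show ?thesis
    using assms(1) by (simp add: measure_measure_pmf_finite)
qed

text \<open>Differences inside a fibre of \<open>f\<close> can only cancel, by the triangle
  inequality. This bounds block distances by the distances on states that occur in
  \<open>d_local\<close>.\<close>

lemma l1_dist_map_pmf_le:
  assumes "finite S" "set_pmf p \<subseteq> S" "set_pmf q \<subseteq> S" "f ` S \<subseteq> X" "finite X"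
  shows "l1_dist X (pmf (map_pmf f p)) (pmf (map_pmf f q)) \<le> l1_dist S (pmf p) (pmf q)"
proof -
  have "l1_dist X (pmf (map_pmf f p)) (pmf (map_pmf f q))
      \<le> (\<Sum>y\<in>X. \<Sum>x\<in>{x\<in>S. f x = y}. \<bar>pmf p x - pmf q x\<bar>)"
    unfolding l1_dist_def
    by (intro sum_mono)
      (simp add: pmf_map_sum[OF assms(1,2)] pmf_map_sum[OF assms(1,3)] sum_abs flip: sum_subtractf)
  also have "\<dots> = l1_dist S (pmf p) (pmf q)"
    unfolding l1_dist_def using assms by (intro sum.group) auto
  finally show ?thesis .
qed

text \<open>Distribute the mass that \<open>\<mu>\<close> gives to a fibre of \<open>f\<close> proportionally to \<open>p\<close>. Inside a fibre all
  differences then have the same sign, so that the norm is not increased.\<close>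

lemma lift_pmf_along_map:
  assumes fin: "finite S" and p: "set_pmf p \<subseteq> S" and \<mu>: "set_pmf \<mu> \<subseteq> f ` S"
  obtains p' where "set_pmf p' \<subseteq> S" "map_pmf f p' = \<mu>"
    "l1_dist S (pmf p') (pmf p) \<le> l1_dist (f ` S) (pmf \<mu>) (pmf (map_pmf f p))"
proof -
  \<comment> \<open>The kernel \<open>k\<close> spreads mass over the fibre of \<open>y\<close> as
    \<open>p\<close> does. On a fibre without mass under \<open>p\<close> the conditional
    distribution is undefined, so a point mass in the fibre serves as default.\<close>
  define k where "k y = (if y \<in> f ` set_pmf p then cond_pmf p (f -` {y})
    else return_pmf (SOME x. x \<in> S \<and> f x = y))" for y
  have k: "set_pmf (k y) \<subseteq> {x\<in>S. f x = y}" if "y \<in> f ` S" for y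
  proof (cases "y \<in> f ` set_pmf p")
    case True
    then have "set_pmf p \<inter> f -` {y} \<noteq> {}"
      by auto
    with True show ?thesis
      using p by (auto simp: k_def set_cond_pmf)
  next
    case False
    have "(SOME x. x \<in> S \<and> f x = y) \<in> {x\<in>S. f x = y}"
      unfolding mem_Collect_eq by (rule someI_ex) (use that in blast)
    with False show ?thesis
      by (simp add: k_def)
  qed
  have pmf_k: "pmf (bind_pmf \<nu> k) x = pmf \<nu> (f x) * pmf (k (f x)) x"
    if \<nu>: "set_pmf \<nu> \<subseteq> f ` S" and x: "x \<in> S" for \<nu> x
  proof -
    have "pmf (bind_pmf \<nu> k) x = (\<Sum>y\<in>f ` S. pmf (k y) x * pmf \<nu> y)"
      unfolding pmf_bind using fin \<nu> by (intro integral_measure_pmf_real) auto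
    also have "\<dots> = (\<Sum>y\<in>{f x}. pmf (k y) x * pmf \<nu> y)"
      using fin x k by (intro sum.mono_neutral_right) (force simp: set_pmf_iff)+
    finally show ?thesis
      by simp
  qed
  \<comment> \<open>Disintegration: \<open>p\<close> is its own image mixed through
    \<open>k\<close>. Hence \<open>p\<close> and the later \<open>p'\<close> use the same kernel and
    differ only in the weights of the fibres.\<close>
  have p_eq: "bind_pmf (map_pmf f p) k = p"
  proof (rule pmf_eqI)
    fix x
    show "pmf (bind_pmf (map_pmf f p) k) x = pmf p x"
    proof (cases "x \<in> set_pmf p")
      case True
      then have "set_pmf p \<inter> f -` {f x} \<noteq> {}"
        by auto
      moreover from this have "measure_pmf.prob p (f -` {f x}) \<noteq> 0"
        by (metis disjoint_iff measure_pmf_zero_iff)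
      ultimately show ?thesis
        using True p by (subst pmf_k) (auto simp: k_def pmf_cond pmf_map)
    next
      case False
      have "x \<notin> set_pmf (k y)" if "y \<in> f ` set_pmf p" for y
      proof -
        have "set_pmf p \<inter> f -` {y} \<noteq> {}"
          using that by auto
        then show ?thesis
          using that False by (auto simp: k_def set_cond_pmf)
      qed
      then have "x \<notin> set_pmf (bind_pmf (map_pmf f p) k)"
        by auto
      with False show ?thesis
        by (metis pmf_eq_0_set_pmf)
    qed
  qed
  define p' where "p' = bind_pmf \<mu> k"
  have "set_pmf p' \<subseteq> S"
    using k \<mu> by (fastforce simp: p'_def)
  moreover have "map_pmf f p' = \<mu>"
  proof -
    have "map_pmf f (k y) = return_pmf y" if "y \<in> set_pmf \<mu>" for y
      using k[of y] that \<mu> by (subst map_pmf_cong[of _ _ _ "\<lambda>_. y"]) auto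
    then have "map_pmf f p' = bind_pmf \<mu> return_pmf"
      unfolding p'_def map_bind_pmf by (intro bind_pmf_cong) auto
    then show ?thesis
      by (simp add: bind_return_pmf')
  qed
  moreover have "l1_dist S (pmf p') (pmf p) \<le> l1_dist (f ` S) (pmf \<mu>) (pmf (map_pmf f p))"
  proof -
    let ?d = "\<lambda>y. \<bar>pmf \<mu> y - pmf (map_pmf f p) y\<bar>"
    have "\<bar>pmf p' x - pmf p x\<bar> = ?d (f x) * pmf (k (f x)) x" if "x \<in> S" for x
    proof -
      have "pmf p x = pmf (map_pmf f p) (f x) * pmf (k (f x)) x"
        using pmf_k[of "map_pmf f p" x] p that by (simp add: p_eq image_mono)
      moreover have "pmf p' x = pmf \<mu> (f x) * pmf (k (f x)) x"
        unfolding p'_def using \<mu> that by (rule pmf_k)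
      ultimately show ?thesis
        by (simp add: abs_mult flip: left_diff_distrib)
    qed
    then have "l1_dist S (pmf p') (pmf p) = (\<Sum>x\<in>S. ?d (f x) * pmf (k (f x)) x)"
      by (simp add: l1_dist_def)
    also have "\<dots> = (\<Sum>y\<in>f ` S. \<Sum>x\<in>{x\<in>S. f x = y}. ?d (f x) * pmf (k (f x)) x)"
      using fin by (rule sum.image_gen)
    also have "\<dots> = (\<Sum>y\<in>f ` S. ?d y * (\<Sum>x\<in>{x\<in>S. f x = y}. pmf (k y) x))"
      by (simp add: sum_distrib_left)
    also have "\<dots> = (\<Sum>y\<in>f ` S. ?d y)"
      using k fin by (intro sum.cong) (auto simp: sum_pmf_eq_1)
    finally show ?thesis
      by (simp add: l1_dist_def)
  qed
  ultimately show thesis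
    by (rule that)
qed


section \<open>Homomorphisms of labelled Markov chains\<close>

text \<open>The equation with \<open>map_pmf\<close> packs the probabilities of all fibres into one
  equality of pmfs, and the image condition makes \<open>f\<close> surjective, so \<open>A\<close>
  and \<open>f\<close> determine \<open>B\<close> on its carrier.\<close>

definition lmc_hom :: "('s \<Rightarrow> 't) \<Rightarrow> ('s, 'l) lmc \<Rightarrow> ('t, 'l) lmc \<Rightarrow> bool" where
  "lmc_hom f A B \<longleftrightarrow> labels B = labels A \<and> states B = f ` states A \<and>
     (\<forall>s\<in>states A. label B (f s) = label A s \<and> tau B (f s) = map_pmf f (tau A s))"

lemma lmc_hom_comp:
  assumes "lmc_hom f A B" "lmc_hom g B C"
  shows "lmc_hom (g \<circ> f) A C"
  using assms by (auto simp: lmc_hom_def pmf.map_comp image_comp)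

lemma lmc_hom_is_lmc:
  assumes "is_lmc A" "lmc_hom f A B"
  shows "is_lmc B"
  unfolding is_lmc_def
proof (intro conjI ballI)
  fix y assume "y \<in> states B"
  then obtain s where "s \<in> states A" "y = f s"
    using assms(2) by (auto simp: lmc_hom_def)
  moreover from this have "set_pmf (tau A s) \<subseteq> states A"
    using assms(1) by (simp add: is_lmc_def)
  ultimately show "set_pmf (tau B y) \<subseteq> states B" "label B y \<in> labels B"
    using assms by (auto simp: is_lmc_def lmc_hom_def image_mono)
qed (use assms in \<open>simp_all add: is_lmc_def lmc_hom_def\<close>)

text \<open>The universal property of quotients: \<open>ker\<close> makes the assignment of
  \<open>g s\<close> to \<open>f s\<close> well defined, surjectivity of \<open>f\<close> makes it
  total on \<open>B\<close>, and pushforwards compose.\<close>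

lemma lmc_hom_factor:
  assumes A: "is_lmc A" and f: "lmc_hom f A B" and g: "lmc_hom g A C"
    and ker: "\<And>s t. s \<in> states A \<Longrightarrow> t \<in> states A \<Longrightarrow> f s = f t \<Longrightarrow> g s = g t"
  obtains h where "lmc_hom h B C" "\<And>s. s \<in> states A \<Longrightarrow> h (f s) = g s"
proof
  define h where "h y = g (SOME s. s \<in> states A \<and> f s = y)" for y
  show h: "h (f s) = g s" if "s \<in> states A" for s
  proof -
    have "(SOME s'. s' \<in> states A \<and> f s' = f s) \<in> states A \<and> f (SOME s'. s' \<in> states A \<and> f s' = f s) = f s"
      by (rule someI[of _ s]) (simp add: that)
    then show ?thesis
      unfolding h_def using ker that by blast
  qed
  have "map_pmf h (map_pmf f (tau A s)) = map_pmf g (tau A s)" if "s \<in> states A" for s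
    unfolding pmf.map_comp using A that h by (intro map_pmf_cong) (auto simp: is_lmc_def)
  moreover have "g ` states A = h ` f ` states A"
    using h by (force simp: image_comp)
  ultimately show "lmc_hom h B C"
    using f g h by (auto simp: lmc_hom_def)
qed

section \<open>Bisimulations as kernels of homomorphisms\<close>

lemma equiv_kernel: "equiv A {(s, t). s \<in> A \<and> t \<in> A \<and> f s = f t}"
  by (intro equivI) (auto simp: refl_on_def sym_def trans_def)

text \<open>A class of the kernel is a fibre of \<open>f\<close> in the carrier. Its probability
  from \<open>s\<close> is a point mass of \<open>tau B (f s)\<close>, which depends on
  \<open>f s\<close> alone.\<close>

lemma bisimulation_kernel:
  assumes A: "is_lmc A" and f: "lmc_hom f A B"
  shows "bisimulation A {(s, t). s \<in> states A \<and> t \<in> states A \<and> f s = f t}"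
proof -
  let ?R = "{(s, t). s \<in> states A \<and> t \<in> states A \<and> f s = f t}"
  have "measure_pmf.prob (tau A s) E = measure_pmf.prob (tau A t) E"
    if st: "s \<in> states A" "t \<in> states A" "f s = f t" and E: "E \<in> states A // ?R" for s t E
  proof -
    obtain u where u: "u \<in> states A" "E = ?R `` {u}"
      using E by (auto elim: quotientE)
    have "measure_pmf.prob (tau A x) E = pmf (tau B (f x)) (f u)" if x: "x \<in> states A" for x
    proof -
      \<comment> \<open>The full preimage may contain points outside the carrier, so the two sets
        agree only almost everywhere.\<close>
      have "measure_pmf.prob (tau A x) E = measure_pmf.prob (tau A x) (f -` {f u})"
        using A u x by (intro measure_pmf.finite_measure_eq_AE)
          (auto simp: AE_measure_pmf_iff is_lmc_def)
      with f x show ?thesis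
        by (simp add: lmc_hom_def pmf_map)
    qed
    with st show ?thesis
      by simp
  qed
  moreover have "label A s = label A t" if "s \<in> states A" "t \<in> states A" "f s = f t" for s t
    using f that by (metis lmc_hom_def)
  ultimately show ?thesis
    unfolding bisimulation_def using equiv_kernel[of "states A" f] by auto
qed

lemma the_block:
  assumes "partition_on S X" "E \<in> X" "t \<in> E"
  shows "(THE F. F \<in> X \<and> t \<in> F) = E"
  using assms by (auto simp: partition_on_def disjoint_def intro!: the_equality)

lemma set_block_distr:
  assumes X: "partition_on S X" and p: "set_pmf p \<subseteq> S"
  shows "set_pmf (block_distr X p) \<subseteq> X"
proof
  fix E assume "E \<in> set_pmf (block_distr X p)"
  then obtain x where x: "x \<in> set_pmf p" "E = (THE F. F \<in> X \<and> x \<in> F)"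
    by (auto simp: block_distr_def)
  then obtain F where "F \<in> X" "x \<in> F"
    using p X by (auto simp: partition_on_def)
  then show "E \<in> X"
    using the_block[OF X] x by simp
qed

text \<open>A bisimulation equates the probabilities of classes. Since neither distribution has mass
  outside the set of classes, this is equality of pmfs.\<close>

lemma block_distr_bisimulation:
  assumes M: "is_lmc M" and R: "bisimulation M R" and st: "(s, t) \<in> R"
  shows "block_distr (states M // R) (tau M s) = block_distr (states M // R) (tau M t)"
proof -
  have eq: "equiv (states M) R"
    using R by (simp add: bisimulation_def)
  have X: "partition_on (states M) (states M // R)"
    by (rule partition_on_quotient[OF eq])
  have s: "s \<in> states M" "t \<in> states M"
    using st eq by (auto simp: equiv_def)
  have sub: "set_pmf (tau M u) \<subseteq> states M" if "u \<in> states M" for u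
    using M that by (simp add: is_lmc_def)
  show ?thesis
  proof (rule pmf_eqI)
    fix E
    show "pmf (block_distr (states M // R) (tau M s)) E = pmf (block_distr (states M // R) (tau M t)) E"
    proof (cases "E \<in> states M // R")
      case True
      then show ?thesis
        using R st sub s by (auto simp: pmf_block_distr[OF X] bisimulation_def)
    next
      case False
      then show ?thesis
        using set_block_distr[OF X sub] s by (metis pmf_eq_0_set_pmf subsetD)
    qed
  qed
qed

text \<open>The converse of \<open>bisimulation_kernel\<close>: \<open>R\<close> is the kernel of
  its quotient map. The representative picked by \<open>SOME\<close> from the class of
  \<open>s\<close> is related to \<open>s\<close>, so its label and block distribution are those of
  \<open>s\<close>.\<close>

lemma lmc_hom_quotient:
  assumes M: "is_lmc M" and R: "bisimulation M R"
  shows "lmc_hom (\<lambda>s. R `` {s}) M (lmc_quotient M R)"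
proof -
  have eq: "equiv (states M) R"
    using R by (simp add: bisimulation_def)
  have X: "partition_on (states M) (states M // R)"
    by (rule partition_on_quotient[OF eq])
  have "label M (SOME x. x \<in> R `` {s}) = label M s \<and>
      block_distr (states M // R) (tau M (SOME x. x \<in> R `` {s})) = map_pmf (\<lambda>s. R `` {s}) (tau M s)"
    if s: "s \<in> states M" for s
  proof -
    have "(SOME x. x \<in> R `` {s}) \<in> R `` {s}"
      using equiv_class_self[OF eq s] by (rule someI)
    then have sx: "(s, SOME x. x \<in> R `` {s}) \<in> R"
      by simp
    have "block_distr (states M // R) (tau M s) = map_pmf (\<lambda>s. R `` {s}) (tau M s)"
      unfolding block_distr_def
    proof (rule map_pmf_cong[OF refl])
      fix x assume "x \<in> set_pmf (tau M s)"
      then have "x \<in> states M"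
        using M s by (auto simp: is_lmc_def)
      then show "(THE E. E \<in> states M // R \<and> x \<in> E) = R `` {x}"
        by (intro the_block[OF X] quotientI equiv_class_self[OF eq])
    qed
    with sx show ?thesis
      using R block_distr_bisimulation[OF M R sx] by (auto simp: bisimulation_def)
  qed
  then show ?thesis
    by (auto simp: lmc_hom_def lmc_quotient_def quotient_def)
qed

lemma lmc_hom_bisim_quotient:
  assumes "is_lmc M"
  shows "lmc_hom (\<lambda>s. bisimilarity M `` {s}) M (bisim_quotient M)"
  unfolding bisim_quotient_def
  using assms bisimilarity_greatest(1) by (intro lmc_hom_quotient)

lemma equiv_bisimilarity:
  assumes "is_lmc M"
  shows "equiv (states M) (bisimilarity M)"
  using bisimilarity_greatest(1)[OF assms] by (simp add: bisimulation_def)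

lemma bisimilarity_class_eq_iff:
  assumes "is_lmc M" "s \<in> states M" "t \<in> states M"
  shows "bisimilarity M `` {s} = bisimilarity M `` {t} \<longleftrightarrow> (s, t) \<in> bisimilarity M"
  using equiv_bisimilarity[OF assms(1)] assms(2,3) by (rule eq_equiv_class_iff)

text \<open>A pair is bisimilar as soon as some homomorphism identifies it, because kernels lie in
  the greatest bisimulation. From \<open>B\<close> to \<open>A\<close> this homomorphism is
  \<open>f\<close> followed by the quotient map of \<open>B\<close>; from \<open>A\<close> to
  \<open>B\<close> it is the quotient map of \<open>A\<close>, factored through
  \<open>f\<close>.\<close>

lemma lmc_hom_bisimilar_iff:
  assumes A: "is_lmc A" and f: "lmc_hom f A B" and st: "s \<in> states A" "t \<in> states A"
  shows "(f s, f t) \<in> bisimilarity B \<longleftrightarrow> (s, t) \<in> bisimilarity A"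
proof
  have B: "is_lmc B"
    using A f by (rule lmc_hom_is_lmc)
  have fS: "f x \<in> states B" if "x \<in> states A" for x
    using f that by (simp add: lmc_hom_def)
  {
    assume "(f s, f t) \<in> bisimilarity B"
    then have "((\<lambda>s. bisimilarity B `` {s}) \<circ> f) s = ((\<lambda>s. bisimilarity B `` {s}) \<circ> f) t"
      using bisimilarity_class_eq_iff[OF B] fS st by simp
    then show "(s, t) \<in> bisimilarity A"
      using bisimilarity_greatest(2)[OF A bisimulation_kernel[OF A
          lmc_hom_comp[OF f lmc_hom_bisim_quotient[OF B]]]] st by auto
  }
  {
    assume "(s, t) \<in> bisimilarity A"
    have "bisimilarity A `` {x} = bisimilarity A `` {y}"
      if "x \<in> states A" "y \<in> states A" "f x = f y" for x y
      using bisimilarity_greatest(2)[OF A bisimulation_kernel[OF A f]] that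
        bisimilarity_class_eq_iff[OF A] by auto
    then obtain h where h: "lmc_hom h B (bisim_quotient A)"
        "\<And>x. x \<in> states A \<Longrightarrow> h (f x) = bisimilarity A `` {x}"
      using lmc_hom_factor[OF A f lmc_hom_bisim_quotient[OF A]] by blast
    have "h (f s) = h (f t)"
      using h(2) bisimilarity_class_eq_iff[OF A] st \<open>(s, t) \<in> bisimilarity A\<close> by simp
    then show "(f s, f t) \<in> bisimilarity B"
      using bisimilarity_greatest(2)[OF B bisimulation_kernel[OF B h(1)]] fS st by auto
  }
qed

section \<open>Isomorphisms and reduced chains\<close>

lemma lmc_iso_imp_hom:
  assumes A: "is_lmc A" and iso: "lmc_iso A B"
  obtains f where "lmc_hom f A B" "inj_on f (states A)"
proof -
  obtain f where f: "labels A = labels B" "bij_betw f (states A) (states B)"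
      "\<And>s. s \<in> states A \<Longrightarrow> label B (f s) = label A s"
      "\<And>s t. s \<in> states A \<Longrightarrow> t \<in> states A \<Longrightarrow> pmf (tau B (f s)) (f t) = pmf (tau A s) t"
    using iso by (auto simp: lmc_iso_def)
  have fin: "finite (states A)"
    using A by (simp add: is_lmc_def)
  have inj: "inj_on f (states A)" and img: "states B = f ` states A"
    using f(2) by (auto simp: bij_betw_def)
  have "tau B (f s) = map_pmf f (tau A s)" if s: "s \<in> states A" for s
  proof (rule pmf_eqI)
    have sub: "set_pmf (tau A s) \<subseteq> states A"
      using A s by (simp add: is_lmc_def)
    \<comment> \<open>\<open>lmc_iso\<close> speaks only of point masses inside the carriers. As
      these sum to 1, \<open>tau B (f s)\<close> has no mass outside
      \<open>states B\<close>.\<close>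
    have "measure_pmf.prob (tau B (f s)) (states B) = (\<Sum>t\<in>states A. pmf (tau A s) t)"
      using fin inj f(4) s unfolding img
      by (simp add: measure_measure_pmf_finite sum.reindex)
    also have "\<dots> = 1"
      using fin sub by (rule sum_pmf_eq_1)
    finally have "set_pmf (tau B (f s)) \<subseteq> states B"
      by (subst (asm) measure_pmf.prob_eq_1) (auto simp: AE_measure_pmf_iff)
    fix y
    show "pmf (tau B (f s)) y = pmf (map_pmf f (tau A s)) y"
    proof (cases "y \<in> states B")
      case True
      then obtain t where t: "t \<in> states A" "y = f t"
        by (auto simp: img)
      then have "{x \<in> states A. f x = y} = {t}"
        using inj by (auto simp: inj_on_def)
      then show ?thesis
        using f(4) s t by (simp add: pmf_map_sum[OF fin sub])
    next
      case False
      then have "{x \<in> states A. f x = y} = {}"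
        by (auto simp: img)
      moreover have "pmf (tau B (f s)) y = 0"
        using False \<open>set_pmf (tau B (f s)) \<subseteq> states B\<close> by (auto simp: pmf_eq_0_set_pmf)
      ultimately show ?thesis
        by (simp only: pmf_map_sum[OF fin sub] sum.empty)
    qed
  qed
  then have "lmc_hom f A B"
    using f img by (auto simp: lmc_hom_def)
  then show thesis
    using inj by (rule that)
qed

lemma inj_hom_imp_iso:
  assumes A: "is_lmc A" and f: "lmc_hom f A B" and inj: "inj_on f (states A)"
  shows "lmc_iso A B"
proof -
  have "pmf (tau B (f s)) (f t) = pmf (tau A s) t" if st: "s \<in> states A" "t \<in> states A" for s t
  proof -
    have fin: "finite (states A)" and sub: "set_pmf (tau A s) \<subseteq> states A"
      using A st by (simp_all add: is_lmc_def)
    have "{x \<in> states A. f x = f t} = {t}"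
      using inj st by (auto simp: inj_on_def)
    then show ?thesis
      using f st by (simp add: lmc_hom_def pmf_map_sum[OF fin sub])
  qed
  then show ?thesis
    using f inj unfolding lmc_iso_def lmc_hom_def bij_betw_def by auto
qed

text \<open>For an LMC \<open>M\<close>, the chains isomorphic to \<open>bisim_quotient M\<close>
  are exactly the reduced images of \<open>M\<close> under homomorphisms; see
  \<open>lmc_iso_bisim_quotientD\<close> and \<open>lmc_iso_bisim_quotientI\<close>.\<close>

definition reduced :: "('s, 'l) lmc \<Rightarrow> bool" where
  "reduced Q \<longleftrightarrow> (\<forall>s\<in>states Q. \<forall>t\<in>states Q. (s, t) \<in> bisimilarity Q \<longrightarrow> s = t)"

lemma reduced_bisim_quotient:
  assumes "is_lmc M"
  shows "reduced (bisim_quotient M)"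
  unfolding reduced_def
proof (intro ballI impI)
  note hom = lmc_hom_bisim_quotient[OF assms]
  fix E F assume "E \<in> states (bisim_quotient M)" "F \<in> states (bisim_quotient M)"
    and EF: "(E, F) \<in> bisimilarity (bisim_quotient M)"
  then obtain s t where "s \<in> states M" "t \<in> states M"
      "E = bisimilarity M `` {s}" "F = bisimilarity M `` {t}"
    using hom by (auto simp: lmc_hom_def)
  with EF show "E = F"
    using lmc_hom_bisimilar_iff[OF assms hom] bisimilarity_class_eq_iff[OF assms] by simp
qed

lemma lmc_iso_bisim_quotientD:
  assumes M: "is_lmc M" and iso: "lmc_iso (bisim_quotient M) Q"
  obtains g where "lmc_hom g M Q" "reduced Q"
proof -
  note hom = lmc_hom_bisim_quotient[OF M]
  note q = lmc_hom_is_lmc[OF M hom]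
  obtain f where f: "lmc_hom f (bisim_quotient M) Q"
    using lmc_iso_imp_hom[OF q iso] .
  have "reduced Q"
    unfolding reduced_def
  proof (intro ballI impI)
    fix x y assume "x \<in> states Q" "y \<in> states Q" and xy: "(x, y) \<in> bisimilarity Q"
    then obtain E F where EF: "E \<in> states (bisim_quotient M)" "F \<in> states (bisim_quotient M)"
        "x = f E" "y = f F"
      using f by (auto simp: lmc_hom_def)
    then have "(E, F) \<in> bisimilarity (bisim_quotient M)"
      using xy lmc_hom_bisimilar_iff[OF q f] by simp
    then show "x = y"
      using EF reduced_bisim_quotient[OF M] by (auto simp: reduced_def)
  qed
  with lmc_hom_comp[OF hom f] show thesis
    by (rule that)
qed

text \<open>In a reduced chain bisimilarity is equality, so \<open>f\<close> and the quotient map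
  have the same kernel. The factor map between their targets is therefore injective.\<close>

lemma lmc_iso_bisim_quotientI:
  assumes M: "is_lmc M" and f: "lmc_hom f M Q" and Q: "reduced Q"
  shows "lmc_iso (bisim_quotient M) Q"
proof -
  note hom = lmc_hom_bisim_quotient[OF M]
  have iff: "f s = f t \<longleftrightarrow> bisimilarity M `` {s} = bisimilarity M `` {t}"
    if st: "s \<in> states M" "t \<in> states M" for s t
  proof -
    have "f s \<in> states Q" "f t \<in> states Q"
      using f st by (auto simp: lmc_hom_def)
    moreover have "equiv (states Q) (bisimilarity Q)"
      using lmc_hom_is_lmc[OF M f] by (rule equiv_bisimilarity)
    ultimately have "f s = f t \<longleftrightarrow> (f s, f t) \<in> bisimilarity Q"
      using Q by (auto simp: reduced_def equiv_def dest: refl_onD)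
    then show ?thesis
      using lmc_hom_bisimilar_iff[OF M f st] bisimilarity_class_eq_iff[OF M st] by simp
  qed
  then obtain h where h: "lmc_hom h (bisim_quotient M) Q"
      "\<And>s. s \<in> states M \<Longrightarrow> h (bisimilarity M `` {s}) = f s"
    using lmc_hom_factor[OF M hom f] by blast
  have "inj_on h (states (bisim_quotient M))"
    using hom h(2) iff by (auto simp: lmc_hom_def inj_on_def)
  then show ?thesis
    using inj_hom_imp_iso lmc_hom_is_lmc[OF M hom] h(1) by blast
qed


section \<open>Perturbed homomorphisms\<close>

text \<open>A relaxation of \<open>eps_quotient\<close> that does not ask \<open>Q\<close> to be
  reduced. It thus also covers the chain between a merge and the following bisimulation
  quotient.\<close>

definition eps_hom :: "real \<Rightarrow> ('s, 'l) lmc \<Rightarrow> ('q, 'l) lmc \<Rightarrow> bool" where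
  "eps_hom e M Q \<longleftrightarrow> (\<exists>\<tau>' f. is_lmc (M\<lparr>tau := \<tau>'\<rparr>) \<and>
     (\<forall>s\<in>states M. l1_dist (states M) (pmf (\<tau>' s)) (pmf (tau M s)) \<le> e) \<and>
     lmc_hom f (M\<lparr>tau := \<tau>'\<rparr>) Q)"

lemma eps_homI:
  assumes "is_lmc (M\<lparr>tau := \<tau>'\<rparr>)" "lmc_hom f (M\<lparr>tau := \<tau>'\<rparr>) Q"
    and "\<And>s. s \<in> states M \<Longrightarrow> l1_dist (states M) (pmf (\<tau>' s)) (pmf (tau M s)) \<le> e"
  shows "eps_hom e M Q"
  unfolding eps_hom_def by (intro exI[of _ \<tau>'] exI[of _ f] conjI ballI assms)

lemma eps_homE:
  assumes "eps_hom e M Q"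
  obtains \<tau>' f where "is_lmc (M\<lparr>tau := \<tau>'\<rparr>)" "lmc_hom f (M\<lparr>tau := \<tau>'\<rparr>) Q"
    "\<And>s. s \<in> states M \<Longrightarrow> l1_dist (states M) (pmf (\<tau>' s)) (pmf (tau M s)) \<le> e"
  using assms unfolding eps_hom_def by (elim exE conjE) (rule that, assumption+, erule bspec)

lemma eps_hom_is_lmc: "eps_hom e M Q \<Longrightarrow> is_lmc Q"
  by (metis eps_hom_def lmc_hom_is_lmc)

text \<open>A further exact quotient keeps the perturbation and only extends the map, so it adds no
  error.\<close>

lemma eps_hom_comp:
  assumes "eps_hom e M Q" "lmc_hom g Q Q'"
  shows "eps_hom e M Q'"
  using assms(1) by (rule eps_homE) (rule eps_homI, assumption, erule lmc_hom_comp[OF _ assms(2)])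

lemma eps_hom_imp_eps_quotient:
  assumes Q: "eps_hom e M Q" "reduced Q"
  shows "eps_quotient e M Q"
proof -
  obtain \<tau>' f where "is_lmc (M\<lparr>tau := \<tau>'\<rparr>)" "lmc_hom f (M\<lparr>tau := \<tau>'\<rparr>) Q"
      "\<And>s. s \<in> states M \<Longrightarrow> l1_dist (states M) (pmf (\<tau>' s)) (pmf (tau M s)) \<le> e"
    using Q(1) by (rule eps_homE) blast
  then show ?thesis
    unfolding eps_quotient_def
    by (intro conjI exI[of _ \<tau>'] ballI eps_hom_is_lmc[OF Q(1)])
      (auto intro: lmc_iso_bisim_quotientI Q(2))
qed

text \<open>The common core of both algorithms. Each perturbed distribution is replaced by a lift of
  the new block distribution along the map from original states to blocks; this moves it by at most
  \<open>e'\<close>, and the triangle inequality adds the two errors.\<close>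

lemma eps_hom_merge:
  assumes Q: "eps_hom e M Q"
    and X: "partition_on (states Q) X"
    and A: "states A = X" "labels A = labels Q"
    and sub: "\<And>E. E \<in> X \<Longrightarrow> set_pmf (tau A E) \<subseteq> X"
    and lab: "\<And>E u. E \<in> X \<Longrightarrow> u \<in> E \<Longrightarrow> label A E = label Q u"
    and dist: "\<And>E u. E \<in> X \<Longrightarrow> u \<in> E \<Longrightarrow>
      l1_dist X (pmf (block_distr X (tau Q u))) (pmf (tau A E)) \<le> e'"
  shows "eps_hom (e + e') M A"
proof -
  obtain \<tau>' f where t: "is_lmc (M\<lparr>tau := \<tau>'\<rparr>)" "lmc_hom f (M\<lparr>tau := \<tau>'\<rparr>) Q"
      "\<And>s. s \<in> states M \<Longrightarrow> l1_dist (states M) (pmf (\<tau>' s)) (pmf (tau M s)) \<le> e"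
    using Q by (rule eps_homE) blast
  define h where "h u = (THE E. E \<in> X \<and> u \<in> E)" for u
  have hE: "h u = E" if "E \<in> X" "u \<in> E" for u E
    unfolding h_def using the_block[OF X that] .
  have h: "h u \<in> X \<and> u \<in> h u" if u: "u \<in> states Q" for u
  proof -
    obtain E where "E \<in> X" "u \<in> E"
      using u partition_onD1[OF X] by auto
    then show ?thesis
      using hE by simp
  qed
  have img: "h ` states Q = X"
  proof (intro subset_antisym subsetI)
    fix E assume E: "E \<in> X"
    then have "E \<noteq> {}"
      using partition_onD3[OF X] by metis
    then obtain u where u: "u \<in> E"
      by blast
    moreover have "u \<in> states Q"
      using u E partition_onD1[OF X] by auto
    ultimately show "E \<in> h ` states Q"
      using hE[OF E] by blast
  qed (use h in auto)
  define g where "g = h \<circ> f"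
  have fS: "states Q = f ` states M"
    using t(2) by (simp add: lmc_hom_def)
  have gS: "g ` states M = X"
    using img fS by (simp add: g_def image_comp)
  have fin: "finite (states M)" and sub': "set_pmf (\<tau>' s) \<subseteq> states M" if "s \<in> states M" for s
    using t(1) that by (auto simp: is_lmc_def)
  have "\<exists>p. set_pmf p \<subseteq> states M \<and> map_pmf g p = tau A (g s) \<and>
      l1_dist (states M) (pmf p) (pmf (tau M s)) \<le> e + e'" if s: "s \<in> states M" for s
  proof -
    have gs: "g s \<in> X" "f s \<in> g s"
      using h s fS by (auto simp: g_def)
    obtain p where p: "set_pmf p \<subseteq> states M" "map_pmf g p = tau A (g s)"
        "l1_dist (states M) (pmf p) (pmf (\<tau>' s))
          \<le> l1_dist (g ` states M) (pmf (tau A (g s))) (pmf (map_pmf g (\<tau>' s)))"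
      using lift_pmf_along_map[OF fin[OF s] sub'[OF s], of "tau A (g s)" g] sub[OF gs(1)] gS by metis
    \<comment> \<open>As \<open>f\<close> is a homomorphism, pushing forward along \<open>g\<close>
      first gives \<open>tau Q (f s)\<close> and then its block distribution, which is what
      \<open>dist\<close> controls.\<close>
    have "map_pmf g (\<tau>' s) = block_distr X (tau Q (f s))"
      using t(2) s by (simp add: lmc_hom_def block_distr_def h_def[abs_def] g_def pmf.map_comp)
    then have "l1_dist (states M) (pmf p) (pmf (\<tau>' s)) \<le> e'"
      using p(3) dist[OF gs] by (simp add: gS l1_dist_commute)
    then have "l1_dist (states M) (pmf p) (pmf (tau M s)) \<le> e + e'"
      using l1_dist_triangle[of "states M" "pmf p" "pmf (tau M s)" "pmf (\<tau>' s)"] t(3)[OF s] by simp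
    with p show ?thesis
      by blast
  qed
  then obtain \<tau>'' where t'': "\<And>s. s \<in> states M \<Longrightarrow> set_pmf (\<tau>'' s) \<subseteq> states M \<and>
      map_pmf g (\<tau>'' s) = tau A (g s) \<and> l1_dist (states M) (pmf (\<tau>'' s)) (pmf (tau M s)) \<le> e + e'"
    by metis
  have "is_lmc (M\<lparr>tau := \<tau>''\<rparr>)"
    using t(1) t'' by (simp add: is_lmc_def)
  moreover have "lmc_hom g (M\<lparr>tau := \<tau>''\<rparr>) A"
  proof -
    have "label A (g s) = label M s" if "s \<in> states M" for s
      using lab[of "g s" "f s"] h[of "f s"] fS t(2) that by (simp add: g_def lmc_hom_def)
    then show ?thesis
      using t'' gS A t(2) by (simp add: lmc_hom_def)
  qed
  ultimately show ?thesis
    using t'' by (intro eps_homI) auto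
qed

lemma set_average_distr:
  assumes "finite E" "E \<noteq> {}"
  shows "set_pmf (average_distr E f) = (\<Union>u\<in>E. set_pmf (f u))"
  using assms by (simp add: average_distr_def)

lemma partition_on_finite_block:
  assumes "partition_on S X" "finite S" "E \<in> X"
  shows "finite E" "E \<noteq> {}" "E \<subseteq> S"
  using assms unfolding partition_on_def by (auto intro: finite_subset)


section \<open>The two minimisation steps\<close>

lemma states_absorbing_lmc [simp]: "states (absorbing_lmc M s t) = states M"
  by (simp add: absorbing_lmc_def)

text \<open>Since \<open>{s, t}\<close> is a class, \<open>R\<close> relates \<open>s\<close> and
  \<open>t\<close> only to each other, and as absorbing states they give mass 1 to this same class.
  All other states keep their transitions.\<close>

lemma bisimulation_absorbing:
  assumes M: "is_lmc M" and \<tau>': "\<forall>x\<in>states M - {s, t}. \<tau>' x = tau M x"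
    and R: "bisimulation (M\<lparr>tau := \<tau>'\<rparr>) R" and cl: "{s, t} \<in> states M // R"
  shows "bisimulation (absorbing_lmc M s t) R"
proof -
  have eq: "equiv (states M) R"
    using R by (simp add: bisimulation_def)
  have closed: "x \<in> E \<longleftrightarrow> y \<in> E" if "E \<in> states M // R" "(x, y) \<in> R" for E x y
    using in_quotient_imp_closed[OF eq that(1)] that(2) eq by (meson equivE symE)
  have "label (absorbing_lmc M s t) x = label (absorbing_lmc M s t) y \<and>
      (\<forall>E\<in>states M // R. measure_pmf.prob (tau (absorbing_lmc M s t) x) E =
        measure_pmf.prob (tau (absorbing_lmc M s t) y) E)"
    if xy: "(x, y) \<in> R" for x y
  proof (cases "x \<in> {s, t}")
    case True
    then have y: "y \<in> {s, t}"
      using closed[OF cl xy] by simp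
    have "(s, t) \<in> R"
      using in_quotient_imp_in_rel[OF eq cl] by simp
    then have "s \<in> E \<longleftrightarrow> t \<in> E" if "E \<in> states M // R" for E
      using closed that by blast
    with True y show ?thesis
      by (auto simp: absorbing_lmc_def measure_return_pmf indicator_def)
  next
    case False
    then have y: "y \<notin> {s, t}"
      using closed[OF cl xy] by simp
    have "x \<in> states M" "y \<in> states M"
      using xy eq by (auto simp: equiv_def)
    then have "\<tau>' x = tau M x" "\<tau>' y = tau M y"
      using \<tau>' False y by auto
    then show ?thesis
      using R xy False y by (fastforce simp: absorbing_lmc_def bisimulation_def)
  qed
  with eq show ?thesis
    unfolding bisimulation_def by auto
qed

lemma is_lmc_absorbing:
  assumes "is_lmc M" "s \<in> states M" "t \<in> states M"
  shows "is_lmc (absorbing_lmc M s t)"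
  using assms by (auto simp: is_lmc_def absorbing_lmc_def)

text \<open>Every bisimulation admitted in \<^const>\<open>local_transitions\<close> refines the associated partition, so
  that no admitted \<open>\<tau>'\<close> distinguishes \<open>s\<close> from \<open>t\<close> on its blocks.\<close>

lemma half_dist_le_d_local:
  assumes M: "is_lmc M" and st: "s \<in> states M" "t \<in> states M" "label M s = label M t"
  defines "X \<equiv> assoc_partition M s t"
  shows "l1_dist X (pmf (block_distr X (tau M s))) (pmf (block_distr X (tau M t))) \<le> 2 * d_local M s t"
proof -
  let ?A = "absorbing_lmc M s t"
  let ?B = "bisimilarity ?A"
  have A: "is_lmc ?A"
    using M st by (intro is_lmc_absorbing)
  have eqB: "equiv (states M) ?B"
    using equiv_bisimilarity[OF A] by (simp add: absorbing_lmc_def)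
  have X: "partition_on (states M) X"
    unfolding X_def assoc_partition_def by (rule partition_on_quotient[OF eqB])
  have fin: "finite (states M)"
    using M by (simp add: is_lmc_def)
  then have finX: "finite X"
    using X by (rule finite_elements)
  have img: "(\<lambda>u. THE E. E \<in> X \<and> u \<in> E) ` states M \<subseteq> X"
  proof (rule image_subsetI)
    fix u assume "u \<in> states M"
    then obtain E where "E \<in> X" "u \<in> E"
      using partition_onD1[OF X] by auto
    then show "(THE E. E \<in> X \<and> u \<in> E) \<in> X"
      using the_block[OF X] by simp
  qed
  let ?b = "\<lambda>p. pmf (block_distr X p)"
  have "l1_dist X (?b (tau M s)) (?b (tau M t)) / 2
      \<le> max (l1_dist (states M) (pmf (\<tau>' s)) (pmf (tau M s)))
             (l1_dist (states M) (pmf (\<tau>' t)) (pmf (tau M t)))"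
    if \<tau>': "\<tau>' \<in> local_transitions M s t" for \<tau>'
  proof -
    obtain R where lmc: "is_lmc (M\<lparr>tau := \<tau>'\<rparr>)" and out: "\<forall>x\<in>states M - {s, t}. \<tau>' x = tau M x"
        and R: "bisimulation (M\<lparr>tau := \<tau>'\<rparr>) R" and cl: "{s, t} \<in> states M // R"
      using \<tau>' by (auto simp: local_transitions_def)
    have eqR: "equiv (states M) R"
      using R by (simp add: bisimulation_def)
    have stR: "(s, t) \<in> R"
      using in_quotient_imp_in_rel[OF eqR cl] by simp
    have RB: "R \<subseteq> ?B"
      using bisimilarity_greatest(2)[OF A bisimulation_absorbing[OF M out R cl]] .
    have XR: "partition_on (states M) (states M // R)"
      by (rule partition_on_quotient[OF eqR])
    have sub: "set_pmf (\<tau>' u) \<subseteq> states M" "set_pmf (tau M u) \<subseteq> states M" if "u \<in> states M" for u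
      using lmc M that by (auto simp: is_lmc_def)
    \<comment> \<open>Because \<open>R\<close> is contained in \<open>?B\<close>, saturating an
      \<open>R\<close>-class under \<open>?B\<close> yields the block of \<open>X\<close> around it.
      So equality of the distributions on \<open>R\<close>-classes passes to
      \<open>X\<close>.\<close>
    have coarsen: "block_distr X (\<tau>' u) =
        map_pmf (\<lambda>F. ?B `` F) (block_distr (states M // R) (\<tau>' u))" if u: "u \<in> states M" for u
      unfolding block_distr_def pmf.map_comp
    proof (rule map_pmf_cong[OF refl])
      fix x assume "x \<in> set_pmf (\<tau>' u)"
      then have x: "x \<in> states M"
        using sub u by blast
      have "(THE E. E \<in> X \<and> x \<in> E) = ?B `` {x}"
        using x equiv_class_self[OF eqB x] by (intro the_block[OF X])
(auto simp: X_def assoc_partition_def intro: quotientI)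
      moreover have "(THE F. F \<in> states M // R \<and> x \<in> F) = R `` {x}"
        using x equiv_class_self[OF eqR x] by (intro the_block[OF XR]) (auto intro: quotientI)
      moreover have "?B `` (R `` {x}) = ?B `` {x}"
      proof (intro subset_antisym subsetI)
        fix y assume "y \<in> ?B `` {x}"
        then show "y \<in> ?B `` (R `` {x})"
          using equiv_class_self[OF eqR x] by blast
      next
        fix y assume "y \<in> ?B `` (R `` {x})"
        then obtain z where "(x, z) \<in> ?B" "(z, y) \<in> ?B"
          using RB by blast
        then have "(x, y) \<in> ?B"
          using eqB by (meson equivE transD)
        then show "y \<in> ?B `` {x}"
          by simp
      qed
      ultimately show "(THE E. E \<in> X \<and> x \<in> E) =
          ((\<lambda>F. ?B `` F) \<circ> (\<lambda>t. THE F. F \<in> states M // R \<and> t \<in> F)) x"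
        by simp
    qed
    have "block_distr X (\<tau>' s) = block_distr X (\<tau>' t)"
      using block_distr_bisimulation[OF lmc R stR] coarsen st by simp
    \<comment> \<open>The path from \<open>s\<close> to \<open>t\<close> runs through their common
      block distribution under \<open>\<tau>'\<close>. Each of its two legs is at most the maximum
      in \<open>d_local\<close>, hence the factor 2.\<close>
    then have "l1_dist X (?b (tau M s)) (?b (tau M t))
        \<le> l1_dist X (?b (\<tau>' s)) (?b (tau M s)) + l1_dist X (?b (\<tau>' t)) (?b (tau M t))"
      using l1_dist_triangle[of X "?b (tau M s)" "?b (tau M t)" "?b (\<tau>' s)"]
      by (simp add: l1_dist_commute)
    moreover have "l1_dist X (?b (\<tau>' u)) (?b (tau M u))
        \<le> l1_dist (states M) (pmf (\<tau>' u)) (pmf (tau M u))" if "u \<in> states M" for u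
      unfolding block_distr_def using sub that by (intro l1_dist_map_pmf_le fin finX img) auto
    ultimately show ?thesis
      using st(1,2) by (smt (verit) field_sum_of_halves max_def)
  qed
  then have "l1_dist X (?b (tau M s)) (?b (tau M t)) / 2 \<le> d_local M s t"
    unfolding d_local_def using local_transitions_nonempty[OF M st] by (intro cINF_greatest)
  then show ?thesis
    by simp
qed

lemma merged_block_in_assoc_partition:
  assumes M: "is_lmc M" and st: "s \<in> states M" "t \<in> states M" "label M s = label M t"
  shows "{s, t} \<in> assoc_partition M s t"
proof -
  let ?A = "absorbing_lmc M s t"
  have A: "is_lmc ?A"
    using M st by (intro is_lmc_absorbing)
  have bis: "bisimulation ?A (bisimilarity ?A)"
    using A by (rule bisimilarity_greatest)
  obtain \<tau>' where "\<tau>' \<in> local_transitions M s t"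
    using local_transitions_nonempty[OF M st] by blast
  then obtain R where out: "\<forall>x\<in>states M - {s, t}. \<tau>' x = tau M x"
      and R: "bisimulation (M\<lparr>tau := \<tau>'\<rparr>) R" and cl: "{s, t} \<in> states M // R"
    by (auto simp: local_transitions_def)
  have "equiv (states M) R"
    using R by (simp add: bisimulation_def)
  then have "R `` {s} = {s, t}"
    using cl by (metis Image_singleton_iff equiv_class_eq_iff insertI1 quotientE)
  then have "{s, t} \<subseteq> bisimilarity ?A `` {s}"
    using bisimilarity_greatest(2)[OF A bisimulation_absorbing[OF M out R cl]] by auto
  moreover have "bisimilarity ?A `` {s} \<subseteq> {s, t}"
  proof
    fix u assume "u \<in> bisimilarity ?A `` {s}"
    then have "label ?A s = label ?A u"
      using bis by (auto simp: bisimulation_def)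
    then show "u \<in> {s, t}"
      by (auto simp: absorbing_lmc_def split: if_splits)
  qed
  ultimately have "bisimilarity ?A `` {s} = {s, t}"
    by blast
  then show ?thesis
    unfolding assoc_partition_def using st by (metis quotientI)
qed

text \<open>Only the block \<open>{s, t}\<close> can incur an error: in any other block the states
  agree exactly on block probabilities, as the absorbing chain leaves their transitions
  unchanged.\<close>

lemma eps_hom_local_merge:
  assumes Q: "eps_hom e M Q" and st: "(s, t) \<in> mergeable_pairs Q" and d: "d_local Q s t \<le> e'" and "e' \<ge> 0"
  shows "eps_hom (e + e') M (local_merge Q s t)"
proof -
  let ?A = "absorbing_lmc Q s t"
  define X where "X = assoc_partition Q s t"
  have lmc: "is_lmc Q"
    using Q by (rule eps_hom_is_lmc)
  have st': "s \<in> states Q" "t \<in> states Q" "label Q s = label Q t" "s \<noteq> t"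
    using st by (auto simp: mergeable_pairs_def)
  have A: "is_lmc ?A"
    using lmc st' by (intro is_lmc_absorbing)
  have bis: "bisimulation ?A (bisimilarity ?A)"
    using A by (rule bisimilarity_greatest)
  have eq: "equiv (states Q) (bisimilarity ?A)"
    using equiv_bisimilarity[OF A] by (simp add: absorbing_lmc_def)
  have X: "partition_on (states Q) X"
    unfolding X_def assoc_partition_def by (rule partition_on_quotient[OF eq])
  have stX: "{s, t} \<in> X"
    unfolding X_def using lmc st' by (intro merged_block_in_assoc_partition)
  have fin: "finite (states Q)"
    using lmc by (simp add: is_lmc_def)
  have some_in: "(SOME u. u \<in> E) \<in> E" if "E \<in> X" for E
    using partition_on_finite_block[OF X fin that] by (simp add: some_in_eq)
  have sub: "set_pmf (block_distr X (tau Q u)) \<subseteq> X" if "u \<in> states Q" for u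
    using set_block_distr[OF X] lmc that by (simp add: is_lmc_def)
  have in_rel: "(u, v) \<in> bisimilarity ?A" if "E \<in> X" "u \<in> E" "v \<in> E" for E u v
    using in_quotient_imp_in_rel[OF eq, of E u v] that by (simp add: X_def assoc_partition_def)
  have not_st: "u \<notin> {s, t}" if "E \<in> X" "E \<noteq> {s, t}" "u \<in> E" for E u
    using that stX X by (metis disjoint_iff partition_onD2 disjointD)
  \<comment> \<open>On \<open>{s, t}\<close> the common label \<open>None\<close> hides the labels
    of \<open>Q\<close>, which agree there by \<open>mergeable_pairs\<close>.\<close>
  have lab: "label Q u = label Q v" if "E \<in> X" "u \<in> E" "v \<in> E" for E u v
  proof (cases "E = {s, t}")
    case True
    with that st' show ?thesis
      by auto
  next
    case False
    have "label ?A u = label ?A v"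
      using bis in_rel[OF that] by (auto simp: bisimulation_def)
    then show ?thesis
      using not_st[OF that(1) False] that by (auto simp: absorbing_lmc_def)
  qed
  have same: "block_distr X (tau Q u) = block_distr X (tau Q v)"
    if "E \<in> X" "E \<noteq> {s, t}" "u \<in> E" "v \<in> E" for E u v
    using block_distr_bisimulation[OF A bis in_rel[OF that(1,3,4)]] not_st[OF that(1,2)] that(3,4)
    by (simp add: X_def assoc_partition_def absorbing_lmc_def)
  have half: "l1_dist X (pmf (block_distr X (tau Q s))) (pmf (block_distr X (tau Q t))) \<le> 2 * e'"
    unfolding X_def using half_dist_le_d_local[OF lmc st'(1-3)] d by linarith
  show ?thesis
  proof (rule eps_hom_merge[OF Q X])
    show "states (local_merge Q s t) = X" "labels (local_merge Q s t) = labels Q"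
      by (simp_all add: local_merge_def X_def Let_def)
  next
    fix E assume E: "E \<in> X"
    have "set_pmf (block_distr X (tau Q (SOME u. u \<in> E))) \<subseteq> X"
      using some_in[OF E] partition_on_finite_block(3)[OF X fin E] sub by blast
    then show "set_pmf (tau (local_merge Q s t) E) \<subseteq> X"
      using sub st' by (auto simp: local_merge_def X_def[symmetric] set_average_distr Let_def)
    fix u assume u: "u \<in> E"
    show "label (local_merge Q s t) E = label Q u"
      using lab[OF E some_in[OF E] u] by (simp add: local_merge_def Let_def)
    show "l1_dist X (pmf (block_distr X (tau Q u))) (pmf (tau (local_merge Q s t) E)) \<le> e'"
    proof (cases "E = {s, t}")
      case True
      have "l1_dist X (pmf (block_distr X (tau Q u)))
          (pmf (average_distr {s, t} (\<lambda>u. block_distr X (tau Q u))))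
        \<le> (\<Sum>v\<in>{s, t}. l1_dist X (pmf (block_distr X (tau Q u))) (pmf (block_distr X (tau Q v)))) / 2"
        using l1_dist_average_distr[of "{s, t}" X "pmf (block_distr X (tau Q u))"
            "\<lambda>u. block_distr X (tau Q u)"] st'(4) by simp
      \<comment> \<open>One of the two summands is the distance of \<open>u\<close> to itself; the
        other is at most \<open>2 * e'\<close> by \<open>half\<close>.\<close>
      also have "\<dots> \<le> e'"
        using half u True st'(4) by (auto simp: l1_dist_commute[of X "pmf (block_distr X (tau Q t))"])
      finally show ?thesis
        using True by (simp add: local_merge_def X_def[symmetric] Let_def)
    next
      case False
      then show ?thesis
        using same[OF E False u some_in[OF E]] \<open>e' \<ge> 0\<close>
        by (simp add: local_merge_def X_def[symmetric] Let_def)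
    qed
  qed
qed

section \<open>The merge by approximate partition refinement\<close>

definition compatible :: "('s, 'l) lmc \<Rightarrow> real \<Rightarrow> 's set set \<Rightarrow> 's set \<Rightarrow> bool" where
  "compatible M e Y E \<longleftrightarrow> (\<forall>u\<in>E. \<forall>v\<in>E. label M u = label M v \<and> block_dist M Y u v \<le> e)"

lemma compatibleD:
  assumes "compatible M e Y E" "u \<in> E" "v \<in> E"
  shows "label M u = label M v" "block_dist M Y u v \<le> e"
  using assms unfolding compatible_def by blast+

text \<open>\<open>ESet\<close> compares \<open>s\<close> with every state of the candidate block,
  so the bound holds for pairs and does not grow as the block grows.\<close>

lemma apr_insert_partition:
  assumes "apr_insert M e Y s X X'" "partition_on D X" "s \<notin> D" "\<forall>E\<in>X. compatible M e Y E" "e \<ge> 0"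
  shows "partition_on (insert s D) X' \<and> (\<forall>E\<in>X'. compatible M e Y E)"
  using assms(1)
proof cases
  case new_block
  have "partition_on (insert s D) (insert {s} X)"
    using assms(2,3) by (auto simp: partition_on_def disjoint_def)
  moreover have "compatible M e Y {s}"
    using \<open>e \<ge> 0\<close> by (simp add: compatible_def block_dist_def)
  ultimately show ?thesis
    using new_block assms(4) by simp
next
  case (join_block E')
  have E': "E' \<in> X" "\<And>t. t \<in> E' \<Longrightarrow> label M s = label M t \<and> block_dist M Y s t \<le> e"
    using join_block(2) by (auto simp: ESet_def)
  have "partition_on (insert s D) (insert (E' \<union> {s}) (X - {E'}))"
    using assms(2,3) E'(1) unfolding partition_on_def disjoint_def by auto
  moreover have "compatible M e Y (E' \<union> {s})"
    unfolding compatible_def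
  proof (intro ballI)
    fix u v assume uv: "u \<in> E' \<union> {s}" "v \<in> E' \<union> {s}"
    have "compatible M e Y E'"
      using assms(4) E'(1) by blast
    note cE = compatibleD[OF this]
    have sym: "block_dist M Y v u = block_dist M Y u v"
      by (simp add: block_dist_def l1_dist_commute)
    consider "u \<in> E'" "v \<in> E'" | "u = s" "v \<in> E'" | "u \<in> E'" "v = s" | "u = s" "v = s"
      using uv by blast
    then show "label M u = label M v \<and> block_dist M Y u v \<le> e"
    proof cases
      case 1
      then show ?thesis
        using cE[OF 1] by simp
    next
      case 2
      then show ?thesis
        using E'(2)[of v] by simp
    next
      case 3
      then show ?thesis
        using E'(2)[of u] sym by simp
    next
      case 4
      then show ?thesis
        using \<open>e \<ge> 0\<close> by (simp add: block_dist_def)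
    qed
  qed
  ultimately show ?thesis
    using join_block assms(4) by simp
qed

text \<open>\<open>D\<close> stands for the states processed so far; it is arbitrary to allow
  induction over the processing order.\<close>

lemma apr_process_partition:
  assumes "apr_process M e Y ss X X'" "partition_on D X" "distinct ss" "set ss \<inter> D = {}"
    "\<forall>E\<in>X. compatible M e Y E" "e \<ge> 0"
  shows "partition_on (set ss \<union> D) X' \<and> (\<forall>E\<in>X'. compatible M e Y E)"
  using assms
proof (induction arbitrary: D)
  case (2 s X X' ss X'')
  have "partition_on (insert s D) X' \<and> (\<forall>E\<in>X'. compatible M e Y E)"
    using 2 by (intro apr_insert_partition) auto
  then have "partition_on (set ss \<union> insert s D) X'' \<and> (\<forall>E\<in>X''. compatible M e Y E)"
    using 2 by (intro "2.IH") auto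
  then show ?case
    by simp
qed simp

lemma apr_split_partition:
  assumes "apr_split M e Y E X" "e \<ge> 0"
  shows "partition_on E X \<and> (\<forall>F\<in>X. compatible M e Y F)"
proof -
  obtain ss where "distinct ss" "set ss = E" "apr_process M e Y ss {} X"
    using assms by (auto simp: apr_split_def)
  then show ?thesis
    using apr_process_partition[of M e Y ss "{}" X "{}"] assms(2) by (auto simp: partition_on_def)
qed

lemma apr_refine_partition:
  assumes "apr_refine M e Y Y'" "partition_on S Y" "e \<ge> 0"
  shows "partition_on S Y' \<and> (\<forall>E\<in>Y'. compatible M e Y E)"
proof -
  obtain X where X: "\<forall>E\<in>Y. apr_split M e Y E (X E)" "Y' = (\<Union>E\<in>Y. X E)"
    using assms(1) by (auto simp: apr_refine_def)
  have E: "partition_on E (X E)" "\<forall>F\<in>X E. compatible M e Y F" if "E \<in> Y" for E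
    using X apr_split_partition assms(3) that by blast+
  have "partition_on S Y'"
  proof (rule partition_onI)
    have "\<Union>Y' = (\<Union>E\<in>Y. \<Union>(X E))"
      using X(2) by auto
    also have "\<dots> = \<Union>Y"
      using partition_onD1[OF E(1)] by simp
    finally show "\<Union>Y' = S"
      using partition_onD1[OF assms(2)] by simp
    show "{} \<notin> Y'"
      using partition_onD3[OF E(1)] X(2) by auto
    fix F G assume "F \<in> Y'" "G \<in> Y'" "F \<noteq> G"
    then obtain E E' where EE': "E \<in> Y" "E' \<in> Y" "F \<in> X E" "G \<in> X E'"
      using X(2) by auto
    show "disjnt F G"
    proof (cases "E = E'")
      case True
      then show ?thesis
        using E(1)[OF EE'(1)] EE' \<open>F \<noteq> G\<close> by (auto simp: partition_on_def disjoint_def disjnt_def)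
    next
      case False
      then have "E \<inter> E' = {}"
        using assms(2) EE' by (auto simp: partition_on_def disjoint_def)
      moreover have "F \<subseteq> E" "G \<subseteq> E'"
        using E(1)[OF EE'(1)] E(1)[OF EE'(2)] EE' by (auto simp: partition_on_def)
      ultimately show ?thesis
        by (auto simp: disjnt_def)
    qed
  qed
  with X(2) E(2) show ?thesis
    by blast
qed

text \<open>A round makes its blocks compatible with respect to the preceding partition. Only the
  stopping condition \<open>Y k = Y (k - 1)\<close> turns this into compatibility with respect to
  \<open>X\<close> itself, and \<open>1 \<le> k\<close> guarantees a last round.\<close>

lemma apr_output_partition:
  assumes "apr_output M e X" "states M \<noteq> {}" "e \<ge> 0"
  shows "partition_on (states M) X" "\<forall>E\<in>X. compatible M e X E"
proof -
  obtain Y and k :: nat where Y: "Y 0 = {states M}" "1 \<le> k"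
      "\<forall>j\<in>{1..k}. apr_refine M e (Y (j - 1)) (Y j)" "Y k = Y (k - 1)" "X = Y k"
    using assms(1) unfolding apr_output_def by blast
  have part: "partition_on (states M) (Y j)" if "j \<le> k" for j
    using that
  proof (induction j)
    case 0
    then show ?case
      using assms(2) by (simp add: Y(1) partition_on_space)
  next
    case (Suc j)
    then show ?case
      using apr_refine_partition[OF _ _ \<open>e \<ge> 0\<close>] Y(3)[rule_format, of "Suc j"] by auto
  qed
  show "partition_on (states M) X"
    using part Y(5) by simp
  show "\<forall>E\<in>X. compatible M e X E"
    using apr_refine_partition[OF Y(3)[rule_format] part \<open>e \<ge> 0\<close>, of k] Y(2,4,5) by simp
qed

text \<open>Members of a block have block distributions pairwise within \<open>e'\<close>, so by
  convexity each is within \<open>e'\<close> of their average.\<close>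

lemma eps_hom_apr_merge:
  assumes Q: "eps_hom e M Q" and out: "apr_output Q e' X" and "e' \<ge> 0"
  shows "eps_hom (e + e') M (apr_merge Q X)"
proof -
  have lmc: "is_lmc Q"
    using Q by (rule eps_hom_is_lmc)
  have fin: "finite (states Q)"
    using lmc by (simp add: is_lmc_def)
  have X: "partition_on (states Q) X" and comp: "\<And>E. E \<in> X \<Longrightarrow> compatible Q e' X E"
    using apr_output_partition[OF out _ \<open>e' \<ge> 0\<close>] lmc by (auto simp: is_lmc_def)
  note blk = partition_on_finite_block[OF X fin]
  have supp: "set_pmf (tau Q u) \<subseteq> states Q" if "u \<in> states Q" for u
    using lmc that by (simp add: is_lmc_def)
  show ?thesis
  proof (rule eps_hom_merge[OF Q X])
    show "states (apr_merge Q X) = X" "labels (apr_merge Q X) = labels Q"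
      by (simp_all add: apr_merge_def)
  next
    fix E assume E: "E \<in> X"
    have "set_pmf (block_distr X (tau Q u)) \<subseteq> X" if "u \<in> E" for u
      using that blk(3)[OF E] supp by (intro set_block_distr[OF X]) auto
    then show "set_pmf (tau (apr_merge Q X) E) \<subseteq> X"
      using blk[OF E] by (auto simp: apr_merge_def set_average_distr)
    fix u assume u: "u \<in> E"
    have "(SOME x. x \<in> E) \<in> E"
      using u by (rule someI)
    then show "label (apr_merge Q X) E = label Q u"
      using compatibleD(1)[OF comp[OF E] _ u] by (simp add: apr_merge_def)
    have "l1_dist X (pmf (block_distr X (tau Q u))) (pmf (block_distr X (tau Q v))) \<le> e'"
      if v: "v \<in> E" for v
    proof -
      have "l1_dist X (pmf (block_distr X (tau Q u))) (pmf (block_distr X (tau Q v))) = block_dist Q X u v"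
        using u v blk(3)[OF E] supp unfolding l1_dist_def block_dist_def
        by (intro sum.cong refl) (subst pmf_block_distr[OF X], auto)+
      then show ?thesis
        using compatibleD(2)[OF comp[OF E] u v] by simp
    qed
    then have "(\<Sum>v\<in>E. l1_dist X (pmf (block_distr X (tau Q u))) (pmf (block_distr X (tau Q v)))) / card E
        \<le> (\<Sum>v\<in>E. e') / card E"
      by (intro divide_right_mono sum_mono) auto
    also have "\<dots> = e'"
      using blk[OF E] by simp
    finally show "l1_dist X (pmf (block_distr X (tau Q u))) (pmf (tau (apr_merge Q X) E)) \<le> e'"
      using l1_dist_average_distr[of E X "pmf (block_distr X (tau Q u))" "\<lambda>u. block_distr X (tau Q u)"]
        blk[OF E] by (simp add: apr_merge_def)
  qed
qed

section \<open>Accumulating the error along a run\<close>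

lemma eps_hom_step:
  fixes M :: "('s, 'l) lmc" and Q Q' :: "('q, 'l) lmc"
  assumes Q: "eps_hom e M Q" and step: "local_step \<epsilon>\<^sub>2 Q Q' \<or> apr_step \<epsilon>\<^sub>2 Q Q'" and pos: "\<epsilon>\<^sub>2 \<ge> 0"
  shows "eps_hom (e + \<epsilon>\<^sub>2) M Q' \<and> reduced Q'"
proof -
  \<comment> \<open>\<open>A\<close> is the merged chain before its bisimulation quotient is taken.
    Its states are blocks, and the isomorphism leads back to the state type of
    \<open>Q\<close>.\<close>
  have "\<exists>A :: ('q set, 'l) lmc. eps_hom (e + \<epsilon>\<^sub>2) M A \<and> lmc_iso (bisim_quotient A) Q'"
    using step
  proof
    assume "local_step \<epsilon>\<^sub>2 Q Q'"
    \<comment> \<open>The loop condition supplies some pair within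
      \<open>\<epsilon>\<^sub>2\<close>; the chosen pair minimises \<open>d_local\<close>, so it is
      within \<open>\<epsilon>\<^sub>2\<close> as well.\<close>
    then obtain s t where "(s, t) \<in> mergeable_pairs Q" "d_local Q s t \<le> \<epsilon>\<^sub>2"
        "lmc_iso (bisim_quotient (local_merge Q s t)) Q'"
      unfolding local_step_def by fastforce
    then show ?thesis
      using eps_hom_local_merge[OF Q _ _ pos] by blast
  next
    assume "apr_step \<epsilon>\<^sub>2 Q Q'"
    then show ?thesis
      using eps_hom_apr_merge[OF Q _ pos] unfolding apr_step_def by blast
  qed
  then show ?thesis
    by (metis eps_hom_is_lmc eps_hom_comp lmc_iso_bisim_quotientD)
qed

theorem corollary8:
  fixes M :: "('s, 'l) lmc"
    and \<tau>\<^sub>\<epsilon> :: "'s \<Rightarrow> 's pmf"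
    and \<epsilon> \<epsilon>\<^sub>2 :: real
    and Q :: "nat \<Rightarrow> ('q, 'l) lmc"
    and n i :: nat
  assumes "\<epsilon> \<ge> 0"
    and "is_lmc M"
    and "is_lmc (M\<lparr>tau := \<tau>\<^sub>\<epsilon>\<rparr>)"
    and "\<forall>s\<in>states M. l1_dist (states M) (pmf (tau M s)) (pmf (\<tau>\<^sub>\<epsilon> s)) \<le> \<epsilon>"
    and "\<epsilon>\<^sub>2 > 0"
    and "local_run (M\<lparr>tau := \<tau>\<^sub>\<epsilon>\<rparr>) \<epsilon>\<^sub>2 Q n \<or> apr_run (M\<lparr>tau := \<tau>\<^sub>\<epsilon>\<rparr>) \<epsilon>\<^sub>2 Q n"
    and "i \<le> n"
  shows "eps_quotient (\<epsilon> + real i * \<epsilon>\<^sub>2) M (Q i)"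
proof -
  have init: "lmc_iso (bisim_quotient (M\<lparr>tau := \<tau>\<^sub>\<epsilon>\<rparr>)) (Q 0)"
    and step: "\<And>j. j < n \<Longrightarrow> local_step \<epsilon>\<^sub>2 (Q j) (Q (Suc j)) \<or> apr_step \<epsilon>\<^sub>2 (Q j) (Q (Suc j))"
    using assms(6) by (auto simp: local_run_def apr_run_def)
  \<comment> \<open>The induction carries a homomorphism, which composes with the next merge;
    \<open>reduced\<close> recovers the isomorphism at the end.\<close>
  have "eps_hom (\<epsilon> + real i * \<epsilon>\<^sub>2) M (Q i) \<and> reduced (Q i)"
    using \<open>i \<le> n\<close>
  proof (induction i)
    case 0
    obtain g where g: "lmc_hom g (M\<lparr>tau := \<tau>\<^sub>\<epsilon>\<rparr>) (Q 0)" "reduced (Q 0)"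
      using lmc_iso_bisim_quotientD[OF assms(3) init] .
    have "eps_hom \<epsilon> M (Q 0)"
      using assms(3) g(1)
    proof (rule eps_homI)
      show "l1_dist (states M) (pmf (\<tau>\<^sub>\<epsilon> s)) (pmf (tau M s)) \<le> \<epsilon>" if "s \<in> states M" for s
        using assms(4) that by (simp add: l1_dist_commute)
    qed
    with g(2) show ?case
      by simp
  next
    case (Suc i)
    then have "eps_hom (\<epsilon> + real i * \<epsilon>\<^sub>2 + \<epsilon>\<^sub>2) M (Q (Suc i)) \<and> reduced (Q (Suc i))"
      using step[of i] assms(5) by (intro eps_hom_step) auto
    then show ?case
      by (simp add: algebra_simps)
  qed
  then show ?thesis
    using eps_hom_imp_eps_quotient by blast
qed

end
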